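(* Let $n \geq 2$. Let $\mathcal{A}$ be the set of all symbols $(\alpha\;\;\beta)$ where $\alpha$ and $\beta$ are addresses in $\Omega$ with $\alpha \perp \beta$. Then Brin's higher-dimensional Thompson group $nV$ has an infinite presentation with generating set $\mathcal{A}$ and all relations $$(\alpha\;\;\beta)^2 = 1,$$ $$(\alpha\;\;\beta)^{(\gamma\;\;\delta)} = \bigl(\alpha\bullet(\gamma\;\;\delta)\;\;\;\beta\bullet(\gamma\;\;\delta)\bigr),$$ $$(\alpha\;\;\beta) = (\alpha\langle 0\rangle_d\;\;\beta\langle 0\rangle_d)\,(\alpha\langle 1\rangle_d\;\;\beta\langle 1\rangle_d),$$ where $\alpha,\beta,\gamma,\delta$ range over all addresses in $\Omega$ such that $\alpha\perp\beta$, $\gamma\perp\delta$ and such that both $\alpha\bullet(\gamma\;\;\delta)$ and $\beta\bullet(\gamma\;\;\delta)$ are defined, and $d$ ranges over all indices with $1\leq d\leq n$.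
   Context: Words and addresses. $\{0,1\}^*$ is the set of finite words over $\{0,1\}$, with empty word $\epsilon$. For words $u,v$, $u\preceq v$ means $u$ is a prefix of $v$, and $u\perp v$ means neither is a prefix of the other. Fix $n\ge 2$. $\Omega=(\{0,1\}^* )^n$; its elements $\alpha=(\alpha_1,\dots,\alpha_n)$ are called addresses. Addresses are multiplied by coordinatewise concatenation. For addresses, $\alpha\perp\beta$ means $\alpha_d\perp\beta_d$ for some index $d$. For a word $w$ and $1\le d\le n$, $\langle w\rangle_d$ denotes the address whose $d$th coordinate is $w$ and all of whose other coordinates are $\epsilon$. The group $nV$. Let $\mathfrak{C}=\{0,1\}^{\mathbb{N}}$ be the Cantor set of infinite words and $\Gamma=\mathfrak{C}^n$. For $\alpha\in\Omega$, let $\Gamma(\alpha)=\{\alpha w: w\in\Gamma\}$ (coordinatewise concatenation). $nV$ is the group of all homeomorphisms $g$ of $\Gamma$ obtained as follows: given two partitions $\Gamma=\bigcup_{i=1}^k\Gamma(\alpha^{(i)})=\bigcup_{i=1}^k\Gamma(\beta^{(i)})$ into the same number of disjoint sets of this form, $g$ maps $\alpha^{(i)}w\mapsto\beta^{(i)}w$ for $1\le i\le k$ and $w\in\Gamma$. Maps are written on the right and composed left to right. The generator $(\alpha\;\;\beta)$ corresponds to the element (transposition) of $nV$ that maps $\alpha w\mapsto\beta w$ and $\beta w\mapsto\alpha w$ for all $w\in\Gamma$ and fixes all other points of $\Gamma$. Partial action. For $\alpha,\beta,\gamma\in\Omega$ with $\alpha\perp\beta$, define $\gamma\bullet(\alpha\;\;\beta)$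 to be $\beta\delta$ if $\gamma=\alpha\delta$ for some $\delta\in\Omega$; $\alpha\delta$ if $\gamma=\beta\delta$ for some $\delta\in\Omega$; $\gamma$ if both $\gamma\perp\alpha$ and $\gamma\perp\beta$; and undefined otherwise. Conjugation: $g^h=h^{-1}gh$. *)

theory Defs
  imports
    "HOL-Analysis.Analysis"
    "HOL-Algebra.Group"
    "HOL-Library.Sublist"
    "HOL-Library.Omega_Words_Fun"
begin

text \<open>
  Letters are Booleans: \<open>False\<close> is 0 and \<open>True\<close> is 1. The number n of coordinates is the
  cardinality of the index type \<open>'n\<close>.
\<close>

type_synonym 'n address = "'n \<Rightarrow> bool list"

text \<open>The topology on this type is the product topology, with \<open>bool\<close> discrete.\<close>

type_synonym 'n cantor = "'n \<Rightarrow> nat \<Rightarrow> bool"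


definition addr_mult :: "'n address \<Rightarrow> 'n address \<Rightarrow> 'n address"  (infixr "\<cdot>\<^sub>a" 70)
  where "\<alpha> \<cdot>\<^sub>a \<beta> = (\<lambda>d. \<alpha> d @ \<beta> d)"

definition addr_perp :: "'n address \<Rightarrow> 'n address \<Rightarrow> bool"  (infix "\<bottom>\<^sub>a" 50)
  where "\<alpha> \<bottom>\<^sub>a \<beta> \<longleftrightarrow> (\<exists>d. parallel (\<alpha> d) (\<beta> d))"

definition addr_single :: "bool list \<Rightarrow> 'n \<Rightarrow> 'n address"
  where "addr_single w d = (\<lambda>_. [])(d := w)"

definition addr_app :: "'n address \<Rightarrow> 'n cantor \<Rightarrow> 'n cantor"  (infixr "\<frown>\<^sub>a" 65)
  where "\<alpha> \<frown>\<^sub>a x = (\<lambda>d. conc (\<alpha> d) (x d))"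

definition cylinder :: "'n address \<Rightarrow> 'n cantor set"
  where "cylinder \<alpha> = range (\<lambda>w. \<alpha> \<frown>\<^sub>a w)"


definition cylinder_partition :: "nat \<Rightarrow> (nat \<Rightarrow> 'n address) \<Rightarrow> bool"
  where "cylinder_partition k \<alpha> \<longleftrightarrow>
    disjoint_family_on (\<lambda>i. cylinder (\<alpha> i)) {1..k} \<and> (\<Union>i\<in>{1..k}. cylinder (\<alpha> i)) = UNIV"

text \<open>Maps act on the right: the product \<open>g h\<close> is first \<open>g\<close>, then \<open>h\<close>.\<close>

definition nV :: "('n cantor \<Rightarrow> 'n cantor) monoid"
  where "nV = \<lparr>
    carrier = {g. (\<exists>h. homeomorphism UNIV UNIV g h) \<and>
      (\<exists>k \<alpha> \<beta>. cylinder_partition k \<alpha> \<and> cylinder_partition k \<beta> \<and>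
        (\<forall>i\<in>{1..k}. \<forall>w. g (\<alpha> i \<frown>\<^sub>a w) = \<beta> i \<frown>\<^sub>a w))},
    mult = (\<lambda>g h. h \<circ> g),
    one = id\<rparr>"

definition transposition :: "'n address \<Rightarrow> 'n address \<Rightarrow> 'n cantor \<Rightarrow> 'n cantor"
  where "transposition \<alpha> \<beta> x =
    (if x \<in> cylinder \<alpha> then \<beta> \<frown>\<^sub>a (THE w. x = \<alpha> \<frown>\<^sub>a w)
     else if x \<in> cylinder \<beta> then \<alpha> \<frown>\<^sub>a (THE w. x = \<beta> \<frown>\<^sub>a w)
     else x)"

text \<open>
  The partial action of the symbol \<open>(\<alpha> \<beta>)\<close>, for \<open>\<alpha> \<bottom>\<^sub>a \<beta>\<close>, on addresses;
  \<open>None\<close> stands for ``undefined''.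
\<close>

definition addr_act :: "'n address \<Rightarrow> 'n address \<times> 'n address \<Rightarrow> 'n address option"  (infixl "\<bullet>\<^sub>a" 65)
  where "\<gamma> \<bullet>\<^sub>a s = (case s of (\<alpha>, \<beta>) \<Rightarrow>
    if \<exists>\<delta>. \<gamma> = \<alpha> \<cdot>\<^sub>a \<delta> then Some (\<beta> \<cdot>\<^sub>a (THE \<delta>. \<gamma> = \<alpha> \<cdot>\<^sub>a \<delta>))
    else if \<exists>\<delta>. \<gamma> = \<beta> \<cdot>\<^sub>a \<delta> then Some (\<alpha> \<cdot>\<^sub>a (THE \<delta>. \<gamma> = \<beta> \<cdot>\<^sub>a \<delta>))
    else if \<gamma> \<bottom>\<^sub>a \<alpha> \<and> \<gamma> \<bottom>\<^sub>a \<beta> then Some \<gamma>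
    else None)"


text \<open>
  Groups given by generators and relations. A group word over \<open>A\<close> is a list of pairs \<open>(a, s)\<close>
  with \<open>a \<in> A\<close>; the pair \<open>(a, True)\<close> stands for the generator \<open>a\<close> and \<open>(a, False)\<close> for its formal
  inverse. A relation \<open>u = v\<close> is the pair \<open>(u, v)\<close> of words. The presented group consists of the
  group words modulo the smallest congruence that contains free cancellation and the relations.
\<close>

type_synonym 'a gword = "('a \<times> bool) list"

definition gwords :: "'a set \<Rightarrow> 'a gword set"
  where "gwords A = lists (A \<times> UNIV)"

definition gen :: "'a \<Rightarrow> 'a gword"
  where "gen a = [(a, True)]"

definition gword_inv :: "'a gword \<Rightarrow> 'a gword"
  where "gword_inv w = rev (map (\<lambda>(a, s). (a, \<not> s)) w)"

inductive_set pres_cong :: "'a set \<Rightarrow> ('a gword \<times> 'a gword) set \<Rightarrow> ('a gword \<times> 'a gword) set"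
  for A R where
  refl: "u \<in> gwords A \<Longrightarrow> (u, u) \<in> pres_cong A R"
| sym: "(u, v) \<in> pres_cong A R \<Longrightarrow> (v, u) \<in> pres_cong A R"
| trans: "(u, v) \<in> pres_cong A R \<Longrightarrow> (v, w) \<in> pres_cong A R \<Longrightarrow> (u, w) \<in> pres_cong A R"
| append: "(u, v) \<in> pres_cong A R \<Longrightarrow> (u', v') \<in> pres_cong A R \<Longrightarrow> (u @ u', v @ v') \<in> pres_cong A R"
| cancel: "a \<in> A \<Longrightarrow> ([(a, s), (a, \<not> s)], []) \<in> pres_cong A R"
| rel: "(u, v) \<in> R \<Longrightarrow> u \<in> gwords A \<Longrightarrow> v \<in> gwords A \<Longrightarrow> (u, v) \<in> pres_cong A R"

definition pres_class :: "'a set \<Rightarrow> ('a gword \<times> 'a gword) set \<Rightarrow> 'a gword \<Rightarrow> 'a gword set"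
  where "pres_class A R w = pres_cong A R `` {w}"

definition presented_group :: "'a set \<Rightarrow> ('a gword \<times> 'a gword) set \<Rightarrow> 'a gword set monoid"
  where "presented_group A R = \<lparr>
    carrier = gwords A // pres_cong A R,
    mult = (\<lambda>X Y. \<Union>u\<in>X. \<Union>v\<in>Y. pres_class A R (u @ v)),
    one = pres_class A R []\<rparr>"

text \<open>
  \<open>G\<close> has the presentation with generators \<open>A\<close> and relations \<open>R\<close>, the generator \<open>a\<close>
  corresponding to the element \<open>\<phi> a\<close>.
\<close>

definition has_presentation ::
    "('g, 'm) monoid_scheme \<Rightarrow> ('a \<Rightarrow> 'g) \<Rightarrow> 'a set \<Rightarrow> ('a gword \<times> 'a gword) set \<Rightarrow> bool"
  where "has_presentation G \<phi> A R \<longleftrightarrow>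
    (\<exists>h \<in> iso (presented_group A R) G. \<forall>a\<in>A. h (pres_class A R (gen a)) = \<phi> a)"

lemma pres_cong_gwords:
  assumes "(u, v) \<in> pres_cong A R"
  shows "u \<in> gwords A" "v \<in> gwords A"
  using assms by (induction rule: pres_cong.induct) (auto simp: gwords_def)

lemma equiv_pres_cong: "equiv (gwords A) (pres_cong A R)"
proof (rule equivI)
  show "pres_cong A R \<subseteq> gwords A \<times> gwords A"
    by (auto dest: pres_cong_gwords)
  show "refl_on (gwords A) (pres_cong A R)"
    by (intro refl_onI pres_cong.refl)
  show "sym (pres_cong A R)"
    by (intro symI) (rule pres_cong.sym)
  show "trans (pres_cong A R)"
    by (intro transI) (rule pres_cong.trans)
qed

lemma pres_class_mult:
  assumes "u \<in> gwords A" "v \<in> gwords A"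
  shows "pres_class A R u \<otimes>\<^bsub>presented_group A R\<^esub> pres_class A R v = pres_class A R (u @ v)"
proof -
  have eq: "pres_class A R (u' @ v') = pres_class A R (u @ v)"
    if "u' \<in> pres_class A R u" "v' \<in> pres_class A R v" for u' v'
  proof -
    have "(u @ v, u' @ v') \<in> pres_cong A R"
      using that by (auto simp: pres_class_def intro: pres_cong.append)
    then show ?thesis
      unfolding pres_class_def using equiv_class_eq[OF equiv_pres_cong] by metis
  qed
  have "u \<in> pres_class A R u" "v \<in> pres_class A R v"
    using assms by (auto simp: pres_class_def intro: pres_cong.refl)
  then have "(\<Union>u'\<in>pres_class A R u. \<Union>v'\<in>pres_class A R v. pres_class A R (u' @ v')) =
      pres_class A R (u @ v)"
    using eq by blast
  then show ?thesis
    by (simp add: presented_group_def)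
qed

lemma carrier_presented_group:
  "carrier (presented_group A R) = pres_class A R ` gwords A"
  by (auto simp: presented_group_def pres_class_def quotient_def)

lemma gword_inv_cancel:
  assumes "w \<in> gwords A"
  shows "(gword_inv w @ w, []) \<in> pres_cong A R"
  using assms
proof (induction w)
  case Nil
  then show ?case by (auto simp: gword_inv_def gwords_def intro: pres_cong.refl)
next
  case (Cons x w)
  obtain a s where x: "x = (a, s)" by (cases x)
  have a: "a \<in> A" and w: "w \<in> gwords A"
    using Cons.prems by (auto simp: x gwords_def)
  have wi: "gword_inv w \<in> gwords A"
    using w by (auto simp: gwords_def gword_inv_def)
  have "([(a, \<not> s), (a, \<not> \<not> s)], []) \<in> pres_cong A R"
    by (rule pres_cong.cancel[OF a])
  from pres_cong.append[OF pres_cong.refl[OF wi] pres_cong.append[OF this pres_cong.refl[OF w]]]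
  have "(gword_inv (x # w) @ (x # w), gword_inv w @ w) \<in> pres_cong A R"
    by (simp add: x gword_inv_def)
  with Cons.IH[OF w] show ?case by (blast intro: pres_cong.trans)
qed

lemma group_presented_group: "group (presented_group A R)"
proof (rule groupI)
  have nil: "[] \<in> gwords A" by (simp add: gwords_def)
  have app: "u @ v \<in> gwords A" if "u \<in> gwords A" "v \<in> gwords A" for u v
    using that by (auto simp: gwords_def)
  have one: "\<one>\<^bsub>presented_group A R\<^esub> = pres_class A R []"
    by (simp add: presented_group_def)
  show "\<one>\<^bsub>presented_group A R\<^esub> \<in> carrier (presented_group A R)"
    using nil by (auto simp: one carrier_presented_group)
  fix x y
  assume x: "x \<in> carrier (presented_group A R)"
  show "\<one>\<^bsub>presented_group A R\<^esub> \<otimes>\<^bsub>presented_group A R\<^esub> x = x"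
    using x nil by (auto simp: one carrier_presented_group pres_class_mult)
  show "\<exists>z\<in>carrier (presented_group A R). z \<otimes>\<^bsub>presented_group A R\<^esub> x = \<one>\<^bsub>presented_group A R\<^esub>"
  proof -
    obtain w where w: "w \<in> gwords A" "x = pres_class A R w"
      using x by (auto simp: carrier_presented_group)
    have wi: "gword_inv w \<in> gwords A"
      using w by (auto simp: gwords_def gword_inv_def)
    have "pres_class A R (gword_inv w @ w) = pres_class A R []"
      unfolding pres_class_def
      by (rule equiv_class_eq[OF equiv_pres_cong gword_inv_cancel[OF w(1)]])
    then show ?thesis
      using w wi by (auto simp: one carrier_presented_group pres_class_mult)
  qed
  assume y: "y \<in> carrier (presented_group A R)"
  show "x \<otimes>\<^bsub>presented_group A R\<^esub> y \<in> carrier (presented_group A R)"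
    using x y app by (auto simp: carrier_presented_group pres_class_mult)
  fix z
  assume "z \<in> carrier (presented_group A R)"
  then show "x \<otimes>\<^bsub>presented_group A R\<^esub> y \<otimes>\<^bsub>presented_group A R\<^esub> z =
      x \<otimes>\<^bsub>presented_group A R\<^esub> (y \<otimes>\<^bsub>presented_group A R\<^esub> z)"
    using x y app by (auto simp: carrier_presented_group pres_class_mult)
qed


definition nV_gens :: "('n address \<times> 'n address) set"
  where "nV_gens = {(\<alpha>, \<beta>). \<alpha> \<bottom>\<^sub>a \<beta>}"

definition nV_rels :: "(('n address \<times> 'n address) gword \<times> ('n address \<times> 'n address) gword) set"
  where "nV_rels =
    {(gen (\<alpha>, \<beta>) @ gen (\<alpha>, \<beta>), []) | \<alpha> \<beta>. \<alpha> \<bottom>\<^sub>a \<beta>}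
    \<union> {(gword_inv (gen (\<gamma>, \<delta>)) @ gen (\<alpha>, \<beta>) @ gen (\<gamma>, \<delta>), gen (\<alpha>', \<beta>')) | \<alpha> \<beta> \<gamma> \<delta> \<alpha>' \<beta>'.
        \<alpha> \<bottom>\<^sub>a \<beta> \<and> \<gamma> \<bottom>\<^sub>a \<delta> \<and> \<alpha> \<bullet>\<^sub>a (\<gamma>, \<delta>) = Some \<alpha>' \<and> \<beta> \<bullet>\<^sub>a (\<gamma>, \<delta>) = Some \<beta>'}
    \<union> {(gen (\<alpha>, \<beta>),
         gen (\<alpha> \<cdot>\<^sub>a addr_single [False] d, \<beta> \<cdot>\<^sub>a addr_single [False] d)
         @ gen (\<alpha> \<cdot>\<^sub>a addr_single [True] d, \<beta> \<cdot>\<^sub>a addr_single [True] d)) | \<alpha> \<beta> d. \<alpha> \<bottom>\<^sub>a \<beta>}"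

end

theory Submission
  imports Defs
begin

text \<open>
  Let \<open>P\<close> be the presented group and \<open>act\<close> the map from \<open>P\<close> to the permutations of Cantor space that
  sends each generator to its transposition. It respects the relations, and the theorem says that
  it is a bijection onto nV. One observation gives both injectivity and surjectivity.

  Say that \<open>g\<close> carries \<open>\<alpha>\<close> to \<open>\<beta>\<close> if \<open>g\<close> maps \<open>\<alpha> w\<close> to \<open>\<beta> w\<close> for all \<open>w\<close>. The second and third
  relations imply that, if the action of \<open>p\<close> carries \<open>\<alpha>\<close> to \<open>\<alpha>'\<close> and \<open>\<beta>\<close> to \<open>\<beta>'\<close>, then conjugation
  by \<open>p\<close> sends the generator of \<open>\<alpha>, \<beta>\<close> to that of \<open>\<alpha>', \<beta>'\<close> (\<open>tr_conj_carries\<close>). So the kernel of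
  \<open>act\<close> is central. Moreover, the transpositions of addresses with equal coordinate lengths
  generate a locally finite subgroup of \<open>P\<close>, a union of symmetric groups, on which \<open>act\<close> is
  injective (\<open>lenpres_faithful\<close>).

  Fix a coordinate \<open>i\<close>, and for a digit \<open>u\<close> write \<open>u\<close> also for the address with \<open>u\<close> in coordinate
  \<open>i\<close>. For a partition \<open>A\<close> of Cantor space into cylinders, the map \<open>\<alpha> u x \<mapsto> u \<alpha> x\<close>, for \<open>\<alpha>\<close> in
  \<open>A\<close>, preserves lengths, so it has a unique lift \<open>h\<^sub>A\<close> to that subgroup. Let \<open>double g\<close> be the map
  \<open>u x \<mapsto> u (g x)\<close>. If \<open>g\<close> carries the members of \<open>A\<close> to those of a partition \<open>B\<close>, then
  \<open>g h\<^sub>B = h\<^sub>A (double g)\<close>, since both sides map \<open>\<alpha> u x\<close> to \<open>u \<beta> x\<close> when \<open>\<alpha>\<close> is carried to \<open>\<beta>\<close>.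
  This identity holds in \<open>P\<close> too: it does not depend on \<open>A\<close>, because \<open>h\<^sub>A\<close> changes in a controlled
  way when a member of \<open>A\<close> is split, it is multiplicative in \<open>g\<close>, and for a generator it is the
  third relation.

  For \<open>k\<close> in the kernel, \<open>A\<close> and \<open>B\<close> can be the trivial partition, and the identity becomes
  \<open>k = double k\<close>. Write \<open>k\<^sub>\<zeta>\<close> for the copy of \<open>k\<close> that acts on the cylinder of \<open>\<zeta>\<close>. Copies at
  incomparable addresses are conjugate by a generator, and equal because they are central. With
  \<open>y = k\<^sub>0 = k\<^sub>1\<close> this gives \<open>k = y y\<close>. The copy of this equation at 0 is
  \<open>y = k\<^sub>0\<^sub>0 k\<^sub>0\<^sub>0 = k\<^sub>1 k\<^sub>1 = y y\<close>. Hence \<open>y\<close> and \<open>k\<close> are trivial. For \<open>g\<close> in nV, the same computation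
  modulo the image of \<open>act\<close>, which nV normalises, shows that \<open>g\<close> lies in the image.
\<close>

section \<open>Addresses and their cylinders\<close>

abbreviation root :: "'n address"
  where "root \<equiv> (\<lambda>_. [])"

abbreviation digit :: "bool \<Rightarrow> 'n \<Rightarrow> 'n address"
  where "digit u d \<equiv> addr_single [u] d"

definition alen :: "'n address \<Rightarrow> 'n \<Rightarrow> nat"
  where "alen \<alpha> = (\<lambda>d. length (\<alpha> d))"

lemma addr_mult_assoc: "(\<alpha> \<cdot>\<^sub>a \<beta>) \<cdot>\<^sub>a \<gamma> = \<alpha> \<cdot>\<^sub>a \<beta> \<cdot>\<^sub>a \<gamma>"
  by (simp add: addr_mult_def)

lemma addr_mult_root [simp]: "\<alpha> \<cdot>\<^sub>a root = \<alpha>" "root \<cdot>\<^sub>a \<alpha> = \<alpha>"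
  by (simp_all add: addr_mult_def)

lemma addr_mult_left_cancel [simp]: "\<alpha> \<cdot>\<^sub>a \<beta> = \<alpha> \<cdot>\<^sub>a \<gamma> \<longleftrightarrow> \<beta> = \<gamma>"
  by (auto simp: addr_mult_def fun_eq_iff)

lemma alen_mult: "alen (\<alpha> \<cdot>\<^sub>a \<beta>) = (\<lambda>d. alen \<alpha> d + alen \<beta> d)"
  by (simp add: alen_def addr_mult_def)

lemma alen_digit: "alen (digit u d) = (\<lambda>e. if e = d then 1 else 0)"
  by (auto simp: alen_def addr_single_def)

lemma app_mult: "(\<alpha> \<cdot>\<^sub>a \<beta>) \<frown>\<^sub>a x = \<alpha> \<frown>\<^sub>a \<beta> \<frown>\<^sub>a x"
  by (simp add: addr_mult_def addr_app_def)

lemma app_root [simp]: "root \<frown>\<^sub>a x = x"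
  by (simp add: addr_app_def)

lemma app_inject [simp]: "\<alpha> \<frown>\<^sub>a x = \<alpha> \<frown>\<^sub>a y \<longleftrightarrow> x = y"
proof
  assume eq: "\<alpha> \<frown>\<^sub>a x = \<alpha> \<frown>\<^sub>a y"
  have "x d = y d" for d
    using fun_cong[OF eq, of d] by (simp add: addr_app_def)
  then show "x = y"
    by (rule ext)
qed simp

lemma app_nth: "(\<alpha> \<frown>\<^sub>a x) d j = (if j < length (\<alpha> d) then \<alpha> d ! j else x d (j - length (\<alpha> d)))"
  by (simp add: addr_app_def conc_def)

text \<open>
  If one coordinate of \<open>\<alpha>\<close> were shorter than that of \<open>\<beta>\<close>, the first letter after it could be chosen
  to disagree with \<open>\<beta>\<close>.
\<close>

lemma address_determined_by_app:
  assumes "\<And>x. \<alpha> \<frown>\<^sub>a x = \<beta> \<frown>\<^sub>a x"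
  shows "\<alpha> = \<beta>"
proof
  fix d
  have no: "\<not> length (\<alpha>' d) < length (\<beta>' d)"
    if "\<And>x. \<alpha>' \<frown>\<^sub>a x = \<beta>' \<frown>\<^sub>a x" for \<alpha>' \<beta>' :: "'a address"
  proof
    assume lt: "length (\<alpha>' d) < length (\<beta>' d)"
    define j where "j = length (\<alpha>' d)"
    have "(\<alpha>' \<frown>\<^sub>a (\<lambda>_ _. \<not> \<beta>' d ! j)) d j = (\<beta>' \<frown>\<^sub>a (\<lambda>_ _. \<not> \<beta>' d ! j)) d j"
      using that by simp
    then show False
      using lt by (simp add: app_nth j_def)
  qed
  have len: "length (\<alpha> d) = length (\<beta> d)"
    using no[of \<alpha> \<beta>] no[of \<beta> \<alpha>] assms by force
  show "\<alpha> d = \<beta> d"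
  proof (rule nth_equalityI[OF len])
    fix j assume "j < length (\<alpha> d)"
    then show "\<alpha> d ! j = \<beta> d ! j"
      using arg_cong[OF assms[of undefined], of "\<lambda>x. x d j"] len by (simp add: app_nth)
  qed
qed

lemma cylinder_iff: "x \<in> cylinder \<alpha> \<longleftrightarrow> (\<forall>d. \<forall>j<length (\<alpha> d). x d j = \<alpha> d ! j)"
proof
  assume r: "\<forall>d. \<forall>j<length (\<alpha> d). x d j = \<alpha> d ! j"
  have "x = \<alpha> \<frown>\<^sub>a (\<lambda>d j. x d (j + length (\<alpha> d)))"
    using r by (auto simp: fun_eq_iff app_nth)
  then show "x \<in> cylinder \<alpha>"
    unfolding cylinder_def by blast
qed (auto simp: cylinder_def app_nth)

lemma app_in_cylinder [simp]: "\<alpha> \<frown>\<^sub>a x \<in> cylinder \<alpha>"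
  by (simp add: cylinder_def)

lemma in_cylinderE:
  assumes "x \<in> cylinder \<alpha>"
  obtains w where "x = \<alpha> \<frown>\<^sub>a w"
  using assms by (auto simp: cylinder_def)

lemma perp_sym: "\<alpha> \<bottom>\<^sub>a \<beta> \<longleftrightarrow> \<beta> \<bottom>\<^sub>a \<alpha>"
  by (auto simp: addr_perp_def)

lemma perp_irrefl [simp]: "\<not> \<alpha> \<bottom>\<^sub>a \<alpha>"
  by (simp add: addr_perp_def parallel_def)

lemma perp_mult_left [simp]: "\<gamma> \<cdot>\<^sub>a \<alpha> \<bottom>\<^sub>a \<gamma> \<cdot>\<^sub>a \<beta> \<longleftrightarrow> \<alpha> \<bottom>\<^sub>a \<beta>"
  by (simp add: addr_perp_def addr_mult_def parallel_def)

lemma perp_extend: "\<alpha> \<bottom>\<^sub>a \<beta> \<Longrightarrow> \<alpha> \<cdot>\<^sub>a \<gamma> \<bottom>\<^sub>a \<beta> \<cdot>\<^sub>a \<delta>"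
  unfolding addr_perp_def addr_mult_def using parallel_append by blast

lemma perp_extend_left: "\<alpha> \<bottom>\<^sub>a \<beta> \<Longrightarrow> \<alpha> \<cdot>\<^sub>a \<gamma> \<bottom>\<^sub>a \<beta>"
  using perp_extend[of \<alpha> \<beta> \<gamma> root] by simp

lemma perp_digits: "digit False d \<bottom>\<^sub>a digit True d"
  unfolding addr_perp_def addr_single_def by (rule exI[of _ d]) auto

lemma perp_digits_sym: "digit True d \<bottom>\<^sub>a digit False d"
  by (subst perp_sym) (rule perp_digits)

lemma comparable_or_perp:
  assumes "\<not> \<alpha> \<bottom>\<^sub>a \<beta>" "alen \<alpha> \<le> alen \<beta>"
  shows "\<exists>\<delta>. \<beta> = \<alpha> \<cdot>\<^sub>a \<delta>"
proof -
  have "Sublist.prefix (\<alpha> d) (\<beta> d)" for d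
  proof -
    have "\<not> parallel (\<alpha> d) (\<beta> d)" "length (\<alpha> d) \<le> length (\<beta> d)"
      using assms by (auto simp: addr_perp_def alen_def le_fun_def)
    then show ?thesis
      by (metis parallelI prefix_order.order_eq_iff prefix_length_le not_equal_is_parallel le_antisym)
  qed
  then have "\<forall>d. \<exists>z. \<beta> d = \<alpha> d @ z"
    by (simp add: Sublist.prefix_def)
  then obtain \<delta> where "\<forall>d. \<beta> d = \<alpha> d @ \<delta> d"
    by metis
  then show ?thesis
    by (auto simp: addr_mult_def fun_eq_iff)
qed

lemma perp_iff_disjoint: "\<alpha> \<bottom>\<^sub>a \<beta> \<longleftrightarrow> cylinder \<alpha> \<inter> cylinder \<beta> = {}"
proof
  assume "\<alpha> \<bottom>\<^sub>a \<beta>"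
  then obtain d where par: "parallel (\<alpha> d) (\<beta> d)"
    by (auto simp: addr_perp_def)
  obtain us b bs c cs where bc: "b \<noteq> c" "\<alpha> d = us @ b # bs" "\<beta> d = us @ c # cs"
    using parallel_decomp[OF par] by blast
  show "cylinder \<alpha> \<inter> cylinder \<beta> = {}"
  proof (intro equals0I, elim IntE)
    fix x assume "x \<in> cylinder \<alpha>" "x \<in> cylinder \<beta>"
    moreover have "length us < length (\<alpha> d)" "length us < length (\<beta> d)"
      using bc by simp_all
    ultimately have "\<alpha> d ! length us = \<beta> d ! length us"
      unfolding cylinder_iff by metis
    then show False
      using bc by simp
  qed
next
  assume dis: "cylinder \<alpha> \<inter> cylinder \<beta> = {}"
  show "\<alpha> \<bottom>\<^sub>a \<beta>"
  proof (rule ccontr)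
    assume "\<not> \<alpha> \<bottom>\<^sub>a \<beta>"
    then have np: "\<not> parallel (\<alpha> d) (\<beta> d)" for d
      by (auto simp: addr_perp_def)
    \<comment> \<open>The coordinatewise longer of the two addresses extends both.\<close>
    define l where "l = (\<lambda>d. if Sublist.prefix (\<alpha> d) (\<beta> d) then \<beta> d else \<alpha> d)"
    have "Sublist.prefix (\<alpha> d) (l d)" "Sublist.prefix (\<beta> d) (l d)" for d
      using np[of d] by (auto simp: l_def parallel_def)
    then have pre: "\<exists>z. l d = \<alpha> d @ z" "\<exists>z. l d = \<beta> d @ z" for d
      by (auto simp: Sublist.prefix_def)
    have "l d ! j = \<alpha> d ! j \<and> j < length (l d)" if "j < length (\<alpha> d)" for d j
      using pre(1)[of d] that by (auto simp: nth_append)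
    moreover have "l d ! j = \<beta> d ! j \<and> j < length (l d)" if "j < length (\<beta> d)" for d j
      using pre(2)[of d] that by (auto simp: nth_append)
    ultimately have "l \<frown>\<^sub>a undefined \<in> cylinder \<alpha>" "l \<frown>\<^sub>a undefined \<in> cylinder \<beta>"
      by (simp_all add: cylinder_iff app_nth)
    then show False
      using dis by blast
  qed
qed

text \<open>
  The form in which the third relation is used. A property of \<open>\<delta>\<close> that passes from both halves
  \<open>\<delta>\<langle>0\<rangle>\<^sub>d\<close>, \<open>\<delta>\<langle>1\<rangle>\<^sub>d\<close> to \<open>\<delta>\<close> needs to be checked only for addresses so long that every partial
  action in question is defined on them.
\<close>

lemma split_induct:
  fixes L :: "'n::finite \<Rightarrow> nat"
  assumes level: "\<And>\<delta>. alen \<delta> = L \<Longrightarrow> Q \<delta>"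
    and split: "\<And>\<delta> d. Q (\<delta> \<cdot>\<^sub>a digit False d) \<Longrightarrow> Q (\<delta> \<cdot>\<^sub>a digit True d) \<Longrightarrow> Q \<delta>"
  shows "Q root"
proof -
  have "Q \<delta>" if "alen \<delta> \<le> L" for \<delta>
    using that
  proof (induction "\<Sum>d\<in>UNIV. L d - alen \<delta> d" arbitrary: \<delta> rule: less_induct)
    case less
    show ?case
    proof (cases "alen \<delta> = L")
      case False
      then obtain d where d: "alen \<delta> d < L d"
        using less.prems by (metis le_funD nle_le order.not_eq_order_implies_strict ext)
      have "Q (\<delta> \<cdot>\<^sub>a digit u d)" for u
      proof (rule less.hyps)
        show "(\<Sum>e\<in>UNIV. L e - alen (\<delta> \<cdot>\<^sub>a digit u d) e) < (\<Sum>e\<in>UNIV. L e - alen \<delta> e)"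
          using d by (intro sum_strict_mono_ex1) (auto simp: alen_mult alen_digit intro!: exI[of _ d])
        show "alen (\<delta> \<cdot>\<^sub>a digit u d) \<le> L"
          using d less.prems by (auto simp: alen_mult alen_digit le_fun_def)
      qed
      then show ?thesis using split by blast
    qed (rule level)
  qed
  then show ?thesis
    by (simp add: alen_def le_fun_def)
qed

definition level :: "('n \<Rightarrow> nat) \<Rightarrow> 'n address set"
  where "level L = {\<alpha>. alen \<alpha> = L}"

lemma finite_level: "finite (level (L :: 'n::finite \<Rightarrow> nat))"
proof (rule finite_subset)
  define m where "m = Max (range L)"
  have "L d \<le> m" for d
    unfolding m_def by simp
  then show "level L \<subseteq> {f. \<forall>d. (d \<in> UNIV \<longrightarrow> f d \<in> {l. set l \<subseteq> UNIV \<and> length l \<le> m}) \<and> (d \<notin> UNIV \<longrightarrow> f d = [])}"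
    by (auto simp: level_def alen_def)
  show "finite {f. \<forall>d. (d \<in> (UNIV :: 'n set) \<longrightarrow> f d \<in> {l :: bool list. set l \<subseteq> UNIV \<and> length l \<le> m}) \<and> (d \<notin> UNIV \<longrightarrow> f d = [])}"
    by (intro finite_set_of_finite_funs finite_lists_length_le) auto
qed

lemma level_cover: "\<exists>\<alpha>\<in>level L. x \<in> cylinder \<alpha>"
  by (rule bexI[of _ "\<lambda>d. map (x d) [0..<L d]"]) (auto simp: cylinder_iff level_def alen_def)

lemma level_perp:
  assumes "\<alpha> \<in> level L" "\<beta> \<in> level L" "\<alpha> \<noteq> \<beta>"
  shows "\<alpha> \<bottom>\<^sub>a \<beta>"
proof (rule ccontr)
  assume "\<not> \<alpha> \<bottom>\<^sub>a \<beta>"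
  then obtain \<delta> where \<delta>: "\<beta> = \<alpha> \<cdot>\<^sub>a \<delta>"
    using comparable_or_perp[of \<alpha> \<beta>] assms by (auto simp: level_def)
  have "alen \<delta> d = 0" for d
  proof -
    have "alen \<beta> d = alen \<alpha> d"
      using assms by (simp add: level_def)
    then show ?thesis
      by (simp add: \<delta> alen_mult)
  qed
  then have "\<delta> = root"
    by (auto simp: alen_def fun_eq_iff)
  then show False using \<delta> assms by simp
qed

text \<open>
  Addresses that are long in every coordinate have a prefix of any prescribed shape \<open>L\<close>; what remains
  is still long, and a map that exchanges the prefix cannot shorten it.
\<close>

lemma deep_decompose:
  assumes "(\<lambda>d. L d + M d) \<le> alen \<gamma>"
  obtains \<alpha> \<delta> where "\<gamma> = \<alpha> \<cdot>\<^sub>a \<delta>" "alen \<alpha> = L" "M \<le> alen \<delta>"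
proof (rule that)
  have l: "L d + M d \<le> length (\<gamma> d)" for d
    using assms by (simp add: le_fun_def alen_def)
  show "\<gamma> = (\<lambda>d. take (L d) (\<gamma> d)) \<cdot>\<^sub>a (\<lambda>d. drop (L d) (\<gamma> d))"
    by (simp add: addr_mult_def)
  show "alen (\<lambda>d. take (L d) (\<gamma> d)) = L" "M \<le> alen (\<lambda>d. drop (L d) (\<gamma> d))"
  proof -
    have "L d \<le> length (\<gamma> d)" "M d \<le> length (\<gamma> d) - L d" for d
      using l[of d] by linarith+
    then show "alen (\<lambda>d. take (L d) (\<gamma> d)) = L" "M \<le> alen (\<lambda>d. drop (L d) (\<gamma> d))"
      by (auto simp: alen_def le_fun_def min_def fun_eq_iff le_antisym)
  qed
qed

section \<open>Prefix replacement and transpositions\<close>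

definition carries :: "('n cantor \<Rightarrow> 'n cantor) \<Rightarrow> 'n address \<Rightarrow> 'n address \<Rightarrow> bool"
  where "carries g \<alpha> \<beta> \<longleftrightarrow> (\<forall>x. g (\<alpha> \<frown>\<^sub>a x) = \<beta> \<frown>\<^sub>a x)"

lemma carriesD: "carries g \<alpha> \<beta> \<Longrightarrow> g (\<alpha> \<frown>\<^sub>a x) = \<beta> \<frown>\<^sub>a x"
  by (simp add: carries_def)

lemma carries_mult: "carries g \<alpha> \<beta> \<Longrightarrow> carries g (\<alpha> \<cdot>\<^sub>a \<delta>) (\<beta> \<cdot>\<^sub>a \<delta>)"
  by (simp add: carries_def app_mult)

lemma carries_unique: "carries g \<alpha> \<beta> \<Longrightarrow> carries g \<alpha> \<gamma> \<Longrightarrow> \<beta> = \<gamma>"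
  by (rule address_determined_by_app) (simp add: carries_def)

lemma carries_comp: "carries g \<alpha> \<beta> \<Longrightarrow> carries h \<beta> \<gamma> \<Longrightarrow> carries (h \<circ> g) \<alpha> \<gamma>"
  by (simp add: carries_def)

lemma carries_id [simp]:
  "carries id \<alpha> \<beta> \<longleftrightarrow> \<alpha> = \<beta>" "carries (\<lambda>x. x) \<alpha> \<beta> \<longleftrightarrow> \<alpha> = \<beta>"
  using carries_unique[of id \<alpha> \<alpha> \<beta>] by (auto simp: carries_def)

lemma carries_image: "carries g \<alpha> \<beta> \<Longrightarrow> g ` cylinder \<alpha> = cylinder \<beta>"
  by (simp add: carries_def cylinder_def image_image)

text \<open>
  Incomparability of addresses is disjointness of their cylinders, so every injective map preserves it.
\<close>

lemma carries_perp:
  assumes "inj g" "carries g \<alpha> \<alpha>'" "carries g \<beta> \<beta>'" "\<alpha> \<bottom>\<^sub>a \<beta>"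
  shows "\<alpha>' \<bottom>\<^sub>a \<beta>'"
proof -
  have "cylinder \<alpha>' \<inter> cylinder \<beta>' = g ` (cylinder \<alpha> \<inter> cylinder \<beta>)"
    using assms by (simp add: carries_image image_Int)
  then show ?thesis
    using assms(4) by (simp add: perp_iff_disjoint)
qed

lemma digit_cover: "\<exists>u w. x = digit u d \<frown>\<^sub>a w"
proof -
  have "x \<in> cylinder (digit (x d 0) d)"
    by (auto simp: cylinder_iff addr_single_def)
  then show ?thesis
    by (metis in_cylinderE)
qed

lemma carries_split:
  assumes "carries g (\<alpha> \<cdot>\<^sub>a digit False d) (\<beta> \<cdot>\<^sub>a digit False d)"
    "carries g (\<alpha> \<cdot>\<^sub>a digit True d) (\<beta> \<cdot>\<^sub>a digit True d)"
  shows "carries g \<alpha> \<beta>"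
  unfolding carries_def
proof
  fix x
  obtain u w where "x = digit u d \<frown>\<^sub>a w"
    using digit_cover[of x d] by blast
  then show "g (\<alpha> \<frown>\<^sub>a x) = \<beta> \<frown>\<^sub>a x"
    using assms[THEN carriesD, of w] by (cases u) (simp_all add: app_mult)
qed

lemma transposition_app1: "transposition \<alpha> \<beta> (\<alpha> \<frown>\<^sub>a x) = \<beta> \<frown>\<^sub>a x"
  by (simp add: transposition_def)

lemma transposition_app2: "\<alpha> \<bottom>\<^sub>a \<beta> \<Longrightarrow> transposition \<alpha> \<beta> (\<beta> \<frown>\<^sub>a x) = \<alpha> \<frown>\<^sub>a x"
  using app_in_cylinder[of \<beta> x] unfolding perp_iff_disjoint transposition_def by auto

lemma transposition_fix: "x \<notin> cylinder \<alpha> \<Longrightarrow> x \<notin> cylinder \<beta> \<Longrightarrow> transposition \<alpha> \<beta> x = x"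
  by (simp add: transposition_def)

lemma carries_transposition:
  assumes "\<alpha> \<bottom>\<^sub>a \<beta>"
  shows "carries (transposition \<alpha> \<beta>) \<alpha> \<beta>" "carries (transposition \<alpha> \<beta>) \<beta> \<alpha>"
    "\<gamma> \<bottom>\<^sub>a \<alpha> \<Longrightarrow> \<gamma> \<bottom>\<^sub>a \<beta> \<Longrightarrow> carries (transposition \<alpha> \<beta>) \<gamma> \<gamma>"
proof -
  show "carries (transposition \<alpha> \<beta>) \<alpha> \<beta>" "carries (transposition \<alpha> \<beta>) \<beta> \<alpha>"
    using assms by (simp_all add: carries_def transposition_app1 transposition_app2)
  assume "\<gamma> \<bottom>\<^sub>a \<alpha>" "\<gamma> \<bottom>\<^sub>a \<beta>"
  then have "\<gamma> \<frown>\<^sub>a x \<notin> cylinder \<alpha>" "\<gamma> \<frown>\<^sub>a x \<notin> cylinder \<beta>" for x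
    unfolding perp_iff_disjoint using app_in_cylinder[of \<gamma> x] by blast+
  then show "carries (transposition \<alpha> \<beta>) \<gamma> \<gamma>"
    by (simp add: carries_def transposition_fix)
qed

lemma transposition_cases:
  obtains w where "x = \<alpha> \<frown>\<^sub>a w" | w where "x = \<beta> \<frown>\<^sub>a w"
  | "x \<notin> cylinder \<alpha>" "x \<notin> cylinder \<beta>"
  by (metis in_cylinderE)

lemma transposition_invol: "\<alpha> \<bottom>\<^sub>a \<beta> \<Longrightarrow> transposition \<alpha> \<beta> (transposition \<alpha> \<beta> x) = x"
  by (rule transposition_cases[where x = x and \<alpha> = \<alpha> and \<beta> = \<beta>])
    (auto simp: transposition_app1 transposition_app2 transposition_fix)

text \<open>
  The second relation holds in nV: \<open>g\<close> maps the two cylinders exchanged by the first transposition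
  onto those exchanged by the second, and their complement to the complement.
\<close>

lemma transposition_conj:
  assumes "inj g" "carries g \<alpha> \<alpha>'" "carries g \<beta> \<beta>'" "\<alpha> \<bottom>\<^sub>a \<beta>"
  shows "g (transposition \<alpha> \<beta> x) = transposition \<alpha>' \<beta>' (g x)"
proof (rule transposition_cases[where x = x and \<alpha> = \<alpha> and \<beta> = \<beta>])
  assume "x \<notin> cylinder \<alpha>" "x \<notin> cylinder \<beta>"
  then show ?thesis
    using carries_image[OF assms(2)] carries_image[OF assms(3)] assms(1)
    by (metis inj_image_mem_iff transposition_fix)
qed (use assms carries_perp[OF assms] in
    \<open>auto simp: transposition_app1 transposition_app2 carries_def\<close>)

lemma transposition_split:
  assumes "\<alpha> \<bottom>\<^sub>a \<beta>"
  shows "transposition \<alpha> \<beta> x = transposition (\<alpha> \<cdot>\<^sub>a digit True d) (\<beta> \<cdot>\<^sub>a digit True d)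
    (transposition (\<alpha> \<cdot>\<^sub>a digit False d) (\<beta> \<cdot>\<^sub>a digit False d) x)" 
proof -
  let ?s = "transposition (\<alpha> \<cdot>\<^sub>a digit True d) (\<beta> \<cdot>\<^sub>a digit True d)"
  let ?t = "transposition (\<alpha> \<cdot>\<^sub>a digit False d) (\<beta> \<cdot>\<^sub>a digit False d)"
  have p: "\<alpha> \<cdot>\<^sub>a digit u d \<bottom>\<^sub>a \<beta> \<cdot>\<^sub>a digit v d" "\<beta> \<cdot>\<^sub>a digit u d \<bottom>\<^sub>a \<alpha> \<cdot>\<^sub>a digit v d" for u v
    using assms perp_extend perp_sym by blast+
  have q: "\<gamma> \<cdot>\<^sub>a digit False d \<bottom>\<^sub>a \<gamma> \<cdot>\<^sub>a digit True d" "\<gamma> \<cdot>\<^sub>a digit True d \<bottom>\<^sub>a \<gamma> \<cdot>\<^sub>a digit False d" for \<gamma>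
    using perp_digits[of d] perp_sym by auto
  note c = carries_transposition[OF p(1)[of False False]] carries_transposition[OF p(1)[of True True]]
  have st: "carries (?s \<circ> ?t) \<alpha> \<beta>" "carries (?s \<circ> ?t) \<beta> \<alpha>"
    by (rule carries_split; rule carries_comp, rule c(1) c(2) c(3)[OF q(2) p(1)] c(3)[OF p(2) q(2)],
        rule c(6)[OF p(2) q(1)] c(6)[OF q(1) p(1)] c(4) c(5))+
  show ?thesis
  proof (rule transposition_cases[where x = x and \<alpha> = \<alpha> and \<beta> = \<beta>])
    assume x: "x \<notin> cylinder \<alpha>" "x \<notin> cylinder \<beta>"
    then have "x \<notin> cylinder (\<alpha> \<cdot>\<^sub>a digit u d)" "x \<notin> cylinder (\<beta> \<cdot>\<^sub>a digit u d)" for u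
      by (auto simp: cylinder_def app_mult)
    then show ?thesis using x by (simp add: transposition_fix)
  qed (use st assms in \<open>auto simp: carries_def transposition_app1 transposition_app2\<close>)
qed

lemma addr_act_carries:
  assumes "\<alpha> \<bullet>\<^sub>a (\<gamma>, \<delta>) = Some \<alpha>'" "\<gamma> \<bottom>\<^sub>a \<delta>"
  shows "carries (transposition \<gamma> \<delta>) \<alpha> \<alpha>'"
  using assms
  by (auto simp: addr_act_def split: if_splits
      intro!: carries_mult carries_transposition[OF assms(2)])

lemma addr_act_deep:
  assumes "alen \<gamma> \<le> alen \<alpha>" "alen \<delta> \<le> alen \<alpha>"
  shows "\<exists>\<alpha>'. \<alpha> \<bullet>\<^sub>a (\<gamma>, \<delta>) = Some \<alpha>'"
proof -
  have "\<alpha> \<bottom>\<^sub>a \<gamma> \<or> (\<exists>\<epsilon>. \<alpha> = \<gamma> \<cdot>\<^sub>a \<epsilon>)" "\<alpha> \<bottom>\<^sub>a \<delta> \<or> (\<exists>\<epsilon>. \<alpha> = \<delta> \<cdot>\<^sub>a \<epsilon>)"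
    using comparable_or_perp assms perp_sym by blast+
  then show ?thesis
    unfolding addr_act_def prod.case by (metis (no_types))
qed

section \<open>The presented group and its action\<close>

fun word_map :: "('n address \<times> 'n address) gword \<Rightarrow> 'n cantor \<Rightarrow> 'n cantor"
  where
    "word_map [] x = x"
  | "word_map (((\<alpha>, \<beta>), s) # w) x = word_map w (transposition \<alpha> \<beta> x)"

lemma word_map_append: "word_map (u @ v) = word_map v \<circ> word_map u"
proof
  show "word_map (u @ v) x = (word_map v \<circ> word_map u) x" for x
    by (induction u x rule: word_map.induct) simp_all
qed

lemma inj_transposition: "\<alpha> \<bottom>\<^sub>a \<beta> \<Longrightarrow> inj (transposition \<alpha> \<beta>)"
  by (metis injI transposition_invol)

lemma bij_transposition: "\<alpha> \<bottom>\<^sub>a \<beta> \<Longrightarrow> bij (transposition \<alpha> \<beta>)"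
  by (rule o_bij[of "transposition \<alpha> \<beta>"]) (auto simp: transposition_invol)

lemma nV_rels_cases:
  assumes "(u, v) \<in> nV_rels"
  obtains (invol) \<alpha> \<beta> where "u = gen (\<alpha>, \<beta>) @ gen (\<alpha>, \<beta>)" "v = []" "\<alpha> \<bottom>\<^sub>a \<beta>"
    | (conj) \<alpha> \<beta> \<gamma> \<delta> \<alpha>' \<beta>' where "u = gword_inv (gen (\<gamma>, \<delta>)) @ gen (\<alpha>, \<beta>) @ gen (\<gamma>, \<delta>)"
        "v = gen (\<alpha>', \<beta>')" "\<alpha> \<bottom>\<^sub>a \<beta>" "\<gamma> \<bottom>\<^sub>a \<delta>"
        "\<alpha> \<bullet>\<^sub>a (\<gamma>, \<delta>) = Some \<alpha>'" "\<beta> \<bullet>\<^sub>a (\<gamma>, \<delta>) = Some \<beta>'"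
    | (split) \<alpha> \<beta> d where "u = gen (\<alpha>, \<beta>)" "v = gen (\<alpha> \<cdot>\<^sub>a digit False d, \<beta> \<cdot>\<^sub>a digit False d)
         @ gen (\<alpha> \<cdot>\<^sub>a digit True d, \<beta> \<cdot>\<^sub>a digit True d)" "\<alpha> \<bottom>\<^sub>a \<beta>"
  using assms unfolding nV_rels_def by blast

lemma word_map_rel:
  assumes "(u, v) \<in> (nV_rels :: (('n address \<times> 'n address) gword \<times> _) set)"
  shows "word_map u = word_map v"
  using assms
proof (cases rule: nV_rels_cases)
  case (invol \<alpha> \<beta>)
  then show ?thesis by (auto simp: gen_def transposition_invol)
next
  case (conj \<alpha> \<beta> \<gamma> \<delta> \<alpha>' \<beta>')
  have "transposition \<gamma> \<delta> (transposition \<alpha> \<beta> (transposition \<gamma> \<delta> x)) = transposition \<alpha>' \<beta>' x" for x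
    using transposition_conj[OF inj_transposition[OF conj(4)] addr_act_carries[OF conj(5,4)]
        addr_act_carries[OF conj(6,4)] conj(3)] conj(4)
    by (simp add: transposition_invol)
  then show ?thesis
    by (auto simp: conj gen_def gword_inv_def fun_eq_iff)
next
  case (split \<alpha> \<beta> d)
  then show ?thesis by (auto simp: gen_def fun_eq_iff transposition_split[where d = d])
qed

lemma word_map_cong: "(u, v) \<in> pres_cong nV_gens nV_rels \<Longrightarrow> word_map u = word_map v"
proof (induction rule: pres_cong.induct)
  case (cancel a s)
  then show ?case
    by (cases a) (auto simp: nV_gens_def transposition_invol)
qed (auto simp: word_map_append word_map_rel)

lemma bij_word_map: "w \<in> gwords nV_gens \<Longrightarrow> bij (word_map w)"
proof (induction w)
  case Nil
  have "word_map [] = (id :: 'a cantor \<Rightarrow> 'a cantor)"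
    by (simp add: fun_eq_iff)
  then show ?case by (metis bij_id)
next
  case (Cons a w)
  obtain \<alpha> \<beta> s where a: "a = ((\<alpha>, \<beta>), s)" by (metis surj_pair)
  have "word_map (a # w) = word_map w \<circ> transposition \<alpha> \<beta>"
    by (simp add: a fun_eq_iff)
  moreover have "\<alpha> \<bottom>\<^sub>a \<beta>" "w \<in> gwords nV_gens"
    using Cons.prems by (auto simp: a gwords_def nV_gens_def)
  ultimately show ?case
    using bij_comp[OF bij_transposition] Cons.IH by metis
qed

lemma addr_act_mult:
  assumes "\<alpha> \<bullet>\<^sub>a (\<gamma>, \<delta>) = Some \<alpha>'"
  shows "(\<zeta> \<cdot>\<^sub>a \<alpha>) \<bullet>\<^sub>a (\<zeta> \<cdot>\<^sub>a \<gamma>, \<zeta> \<cdot>\<^sub>a \<delta>) = Some (\<zeta> \<cdot>\<^sub>a \<alpha>')"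
  using assms by (auto simp: addr_act_def addr_mult_assoc split: if_splits)

definition word_prefix :: "'n address \<Rightarrow> ('n address \<times> 'n address) gword \<Rightarrow> ('n address \<times> 'n address) gword"
  where "word_prefix \<zeta> = map (\<lambda>((\<alpha>, \<beta>), s). ((\<zeta> \<cdot>\<^sub>a \<alpha>, \<zeta> \<cdot>\<^sub>a \<beta>), s))"

lemma word_prefix_append: "word_prefix \<zeta> (u @ v) = word_prefix \<zeta> u @ word_prefix \<zeta> v"
  by (simp add: word_prefix_def)

lemma word_prefix_gwords: "w \<in> gwords nV_gens \<Longrightarrow> word_prefix \<zeta> w \<in> gwords nV_gens"
  by (induction w) (auto simp: word_prefix_def gwords_def nV_gens_def)

lemma word_prefix_rel:
  assumes "(u, v) \<in> nV_rels"
  shows "(word_prefix \<zeta> u, word_prefix \<zeta> v) \<in> nV_rels"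
  using assms
proof (cases rule: nV_rels_cases)
  case (invol \<alpha> \<beta>)
  then have "word_prefix \<zeta> u = gen (\<zeta> \<cdot>\<^sub>a \<alpha>, \<zeta> \<cdot>\<^sub>a \<beta>) @ gen (\<zeta> \<cdot>\<^sub>a \<alpha>, \<zeta> \<cdot>\<^sub>a \<beta>)" "word_prefix \<zeta> v = []"
    "\<zeta> \<cdot>\<^sub>a \<alpha> \<bottom>\<^sub>a \<zeta> \<cdot>\<^sub>a \<beta>"
    by (simp_all add: word_prefix_def gen_def)
  then show ?thesis unfolding nV_rels_def by blast
next
  case (conj \<alpha> \<beta> \<gamma> \<delta> \<alpha>' \<beta>')
  then have "word_prefix \<zeta> u = gword_inv (gen (\<zeta> \<cdot>\<^sub>a \<gamma>, \<zeta> \<cdot>\<^sub>a \<delta>)) @ gen (\<zeta> \<cdot>\<^sub>a \<alpha>, \<zeta> \<cdot>\<^sub>a \<beta>) @ gen (\<zeta> \<cdot>\<^sub>a \<gamma>, \<zeta> \<cdot>\<^sub>a \<delta>)"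
      "word_prefix \<zeta> v = gen (\<zeta> \<cdot>\<^sub>a \<alpha>', \<zeta> \<cdot>\<^sub>a \<beta>')" "\<zeta> \<cdot>\<^sub>a \<alpha> \<bottom>\<^sub>a \<zeta> \<cdot>\<^sub>a \<beta>" "\<zeta> \<cdot>\<^sub>a \<gamma> \<bottom>\<^sub>a \<zeta> \<cdot>\<^sub>a \<delta>"
      "(\<zeta> \<cdot>\<^sub>a \<alpha>) \<bullet>\<^sub>a (\<zeta> \<cdot>\<^sub>a \<gamma>, \<zeta> \<cdot>\<^sub>a \<delta>) = Some (\<zeta> \<cdot>\<^sub>a \<alpha>')" "(\<zeta> \<cdot>\<^sub>a \<beta>) \<bullet>\<^sub>a (\<zeta> \<cdot>\<^sub>a \<gamma>, \<zeta> \<cdot>\<^sub>a \<delta>) = Some (\<zeta> \<cdot>\<^sub>a \<beta>')"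
    by (simp_all add: word_prefix_def gen_def gword_inv_def addr_act_mult)
  then show ?thesis unfolding nV_rels_def by blast
next
  case (split \<alpha> \<beta> d)
  then have "word_prefix \<zeta> u = gen (\<zeta> \<cdot>\<^sub>a \<alpha>, \<zeta> \<cdot>\<^sub>a \<beta>)"
    "word_prefix \<zeta> v = gen ((\<zeta> \<cdot>\<^sub>a \<alpha>) \<cdot>\<^sub>a digit False d, (\<zeta> \<cdot>\<^sub>a \<beta>) \<cdot>\<^sub>a digit False d)
       @ gen ((\<zeta> \<cdot>\<^sub>a \<alpha>) \<cdot>\<^sub>a digit True d, (\<zeta> \<cdot>\<^sub>a \<beta>) \<cdot>\<^sub>a digit True d)" "\<zeta> \<cdot>\<^sub>a \<alpha> \<bottom>\<^sub>a \<zeta> \<cdot>\<^sub>a \<beta>"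
    by (simp_all add: word_prefix_def gen_def addr_mult_assoc)
  then show ?thesis unfolding nV_rels_def by blast
qed

lemma word_prefix_cong:
  "(u, v) \<in> pres_cong nV_gens nV_rels \<Longrightarrow> (word_prefix \<zeta> u, word_prefix \<zeta> v) \<in> pres_cong nV_gens nV_rels"
proof (induction rule: pres_cong.induct)
  case (trans u v w)
  then show ?case by (blast intro: pres_cong.trans)
next
  case (append u v u' v')
  then show ?case by (auto simp: word_prefix_def intro: pres_cong.append)
next
  case (cancel a s)
  then show ?case
    by (cases a) (auto simp: nV_gens_def word_prefix_def intro!: pres_cong.cancel)
qed (auto intro: pres_cong.intros word_prefix_gwords word_prefix_rel)

text \<open>
  The presented group as a type, written additively although it is not commutative, as an instance
  of \<^class>\<open>group_add\<close>. A sum acts by its left summand first.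
\<close>

quotient_type 'n nV_pres = "('n address \<times> 'n address) gword" /
  partial: "\<lambda>u v. (u, v) \<in> pres_cong nV_gens nV_rels"
proof (rule part_equivpI)
  show "\<exists>u. (u :: ('n address \<times> 'n address) gword, u) \<in> pres_cong nV_gens nV_rels"
    by (rule exI[of _ "[]"]) (simp add: pres_cong.refl gwords_def)
  show "symp (\<lambda>u v. (u, v) \<in> pres_cong nV_gens nV_rels)"
    by (auto intro: sympI pres_cong.sym)
  show "transp (\<lambda>u v. (u, v) \<in> pres_cong nV_gens nV_rels)"
    by (auto intro: transpI pres_cong.trans)
qed

lemma gword_inv_inv: "gword_inv (gword_inv w) = w"
  by (induction w) (auto simp: gword_inv_def)

lemma gword_inv_gwords: "w \<in> gwords A \<Longrightarrow> gword_inv w \<in> gwords A"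
  by (auto simp: gwords_def gword_inv_def)

lemma gword_inv_cong:
  assumes "(u, v) \<in> pres_cong A R"
  shows "(gword_inv u, gword_inv v) \<in> pres_cong A R"
proof -
  note w = pres_cong_gwords[OF assms] pres_cong_gwords[OF assms, THEN gword_inv_gwords]
  note r = pres_cong.refl[OF w(3)] pres_cong.refl[OF w(4)]
  have 1: "(gword_inv u @ v @ gword_inv v, gword_inv u) \<in> pres_cong A R"
    using pres_cong.append[OF r(1) gword_inv_cancel[OF w(4)]] by (simp add: gword_inv_inv)
  have "(gword_inv u @ v, []) \<in> pres_cong A R"
    using pres_cong.append[OF r(1) pres_cong.sym[OF assms]] gword_inv_cancel[OF w(1)]
    by (rule pres_cong.trans)
  from pres_cong.append[OF this r(2)]
  have 2: "(gword_inv u @ v @ gword_inv v, gword_inv v) \<in> pres_cong A R"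
    by simp
  show ?thesis
    using pres_cong.trans[OF pres_cong.sym[OF 1] 2] .
qed

instantiation nV_pres :: (type) group_add
begin

lift_definition zero_nV_pres :: "'a nV_pres" is "[]"
  by (simp add: pres_cong.refl gwords_def)

lift_definition plus_nV_pres :: "'a nV_pres \<Rightarrow> 'a nV_pres \<Rightarrow> 'a nV_pres" is "(@)"
  by (rule pres_cong.append)

lift_definition uminus_nV_pres :: "'a nV_pres \<Rightarrow> 'a nV_pres" is gword_inv
  by (rule gword_inv_cong)

definition minus_nV_pres :: "'a nV_pres \<Rightarrow> 'a nV_pres \<Rightarrow> 'a nV_pres"
  where "minus_nV_pres p q = p + - q"

instance
proof
  fix p q r :: "'a nV_pres"
  show "p + q + r = p + (q + r)"
    by transfer (simp, intro pres_cong.append)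
  show "0 + p = p"
    by transfer simp
  show "p + 0 = p"
    by transfer simp
  show "- p + p = 0"
    by transfer (auto intro!: gword_inv_cancel dest: pres_cong_gwords)
  show "p + - q = p - q"
    by (simp add: minus_nV_pres_def)
qed

end

text \<open>
  The generator, made total by the value 0 on pairs of comparable addresses.
\<close>

lift_definition tr :: "'n address \<Rightarrow> 'n address \<Rightarrow> 'n nV_pres"
  is "\<lambda>\<alpha> \<beta>. if \<alpha> \<bottom>\<^sub>a \<beta> then gen (\<alpha>, \<beta>) else []"
  by (auto intro!: pres_cong.refl simp: gwords_def gen_def nV_gens_def)

lift_definition act :: "'n nV_pres \<Rightarrow> 'n cantor \<Rightarrow> 'n cantor" is word_map
  by (rule word_map_cong)

text \<open>
  The copy of an element inside the cylinder of \<open>\<zeta>\<close>.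
\<close>

lift_definition pfx :: "'n address \<Rightarrow> 'n nV_pres \<Rightarrow> 'n nV_pres" is word_prefix
  by (rule word_prefix_cong)

lemma tr_invol [simp]: "tr \<alpha> \<beta> + tr \<alpha> \<beta> = 0"
  by transfer (auto intro!: pres_cong.rel pres_cong.refl simp: nV_rels_def gwords_def gen_def nV_gens_def)

lemma uminus_tr [simp]: "- tr \<alpha> \<beta> = tr \<alpha> \<beta>"
  using minus_unique tr_invol by blast

lemma tr_not_perp [simp]: "\<not> \<alpha> \<bottom>\<^sub>a \<beta> \<Longrightarrow> tr \<alpha> \<beta> = 0"
  by transfer (simp add: pres_cong.refl gwords_def)

lemma tr_conj:
  assumes "\<alpha> \<bottom>\<^sub>a \<beta>" "\<gamma> \<bottom>\<^sub>a \<delta>" "\<alpha> \<bullet>\<^sub>a (\<gamma>, \<delta>) = Some \<alpha>'" "\<beta> \<bullet>\<^sub>a (\<gamma>, \<delta>) = Some \<beta>'"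
  shows "- tr \<gamma> \<delta> + tr \<alpha> \<beta> + tr \<gamma> \<delta> = tr \<alpha>' \<beta>'"
proof -
  have p: "\<alpha>' \<bottom>\<^sub>a \<beta>'"
    using carries_perp[OF inj_transposition] addr_act_carries assms by blast
  show ?thesis
    using assms p
    by transfer (auto intro!: pres_cong.rel simp: nV_rels_def gwords_def gen_def nV_gens_def gword_inv_def)
qed

lemma tr_split:
  "tr \<alpha> \<beta> = tr (\<alpha> \<cdot>\<^sub>a digit False d) (\<beta> \<cdot>\<^sub>a digit False d) + tr (\<alpha> \<cdot>\<^sub>a digit True d) (\<beta> \<cdot>\<^sub>a digit True d)"
  if "\<alpha> \<bottom>\<^sub>a \<beta>"
  using that perp_extend[OF that]
  by transfer (auto intro!: pres_cong.rel simp: nV_rels_def gwords_def gen_def nV_gens_def)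

text \<open>
  Generators are involutions, so formal inverses are not needed to reach every element.
\<close>

lemma nV_pres_induct [case_names zero step]:
  assumes zero: "Q 0" and step: "\<And>p \<alpha> \<beta>. \<alpha> \<bottom>\<^sub>a \<beta> \<Longrightarrow> Q p \<Longrightarrow> Q (p + tr \<alpha> \<beta>)"
  shows "Q p"
proof -
  have "Q (abs_nV_pres w)" if "w \<in> gwords nV_gens" for w
    using that
  proof (induction w rule: rev_induct)
    case Nil
    then show ?case using zero by (simp add: zero_nV_pres_def)
  next
    case (snoc a w)
    obtain \<alpha> \<beta> s where a: "a = ((\<alpha>, \<beta>), s)" by (metis surj_pair)
    have p: "\<alpha> \<bottom>\<^sub>a \<beta>" and w: "w \<in> gwords nV_gens"
      using snoc.prems by (auto simp: a gwords_def nV_gens_def)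
    have g: "gen (\<alpha>, \<beta>) \<in> gwords nV_gens"
      using p by (simp add: gen_def gwords_def nV_gens_def)
    have "abs_nV_pres [a] = (if s then tr \<alpha> \<beta> else - tr \<alpha> \<beta>)"
      using p g by (simp add: a tr_def uminus_nV_pres.abs_eq pres_cong.refl gen_def gword_inv_def del: uminus_tr)
    then have "abs_nV_pres (w @ [a]) = abs_nV_pres w + tr \<alpha> \<beta>"
      using snoc.prems w by (subst plus_nV_pres.abs_eq[symmetric]) (auto intro: pres_cong.refl simp: gwords_def)
    then show ?case
      using step[OF p snoc.IH[OF w]] by simp
  qed
  then show ?thesis
    by (induction p rule: nV_pres.abs_induct) (simp add: pres_cong_gwords(1))
qed

lemma act_zero [simp]: "act 0 = id"
  by transfer (simp add: fun_eq_iff)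

lemma act_add: "act (p + q) = act q \<circ> act p"
  by transfer (rule word_map_append)

lemma act_tr: "\<alpha> \<bottom>\<^sub>a \<beta> \<Longrightarrow> act (tr \<alpha> \<beta>) = transposition \<alpha> \<beta>"
  by transfer (simp add: gen_def fun_eq_iff)

lemma bij_act: "bij (act p)"
  by transfer (auto intro: bij_word_map dest: pres_cong_gwords)

lemma inj_act: "inj (act p)"
  using bij_act by (rule bij_is_inj)

lemma pfx_zero [simp]: "pfx \<zeta> 0 = 0"
  by transfer (simp add: word_prefix_def pres_cong.refl gwords_def)

lemma pfx_add: "pfx \<zeta> (p + q) = pfx \<zeta> p + pfx \<zeta> q"
  by transfer (simp add: word_prefix_append, intro pres_cong.append word_prefix_cong)

lemma pfx_tr: "pfx \<zeta> (tr \<alpha> \<beta>) = tr (\<zeta> \<cdot>\<^sub>a \<alpha>) (\<zeta> \<cdot>\<^sub>a \<beta>)"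
  by transfer (auto simp: word_prefix_def gen_def gwords_def nV_gens_def intro!: pres_cong.refl)

lemma pfx_pfx: "pfx \<zeta> (pfx \<eta> p) = pfx (\<zeta> \<cdot>\<^sub>a \<eta>) p"
  by (induction p rule: nV_pres_induct) (simp_all add: pfx_add pfx_tr addr_mult_assoc)

lemma act_uminus: "act (- p) (act p x) = x" "act p (act (- p) x) = x"
  using act_add[of p "- p"] act_add[of "- p" p] by (simp_all add: fun_eq_iff)

lemma act_pfx_app: "act (pfx \<zeta> p) (\<zeta> \<frown>\<^sub>a x) = \<zeta> \<frown>\<^sub>a act p x"
proof (induction p arbitrary: x rule: nV_pres_induct)
  case (step p \<alpha> \<beta>)
  have "carries (transposition (\<zeta> \<cdot>\<^sub>a \<alpha>) (\<zeta> \<cdot>\<^sub>a \<beta>)) (\<zeta> \<cdot>\<^sub>a \<alpha>) (\<zeta> \<cdot>\<^sub>a \<beta>)"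
     "carries (transposition (\<zeta> \<cdot>\<^sub>a \<alpha>) (\<zeta> \<cdot>\<^sub>a \<beta>)) (\<zeta> \<cdot>\<^sub>a \<beta>) (\<zeta> \<cdot>\<^sub>a \<alpha>)"
    using step.hyps by (auto intro: carries_transposition)
  moreover have "\<zeta> \<frown>\<^sub>a y \<in> cylinder (\<zeta> \<cdot>\<^sub>a \<gamma>) \<longleftrightarrow> y \<in> cylinder \<gamma>" for y \<gamma>
    by (auto simp: cylinder_def app_mult)
  ultimately have "transposition (\<zeta> \<cdot>\<^sub>a \<alpha>) (\<zeta> \<cdot>\<^sub>a \<beta>) (\<zeta> \<frown>\<^sub>a y) = \<zeta> \<frown>\<^sub>a transposition \<alpha> \<beta> y" for y
    using step.hyps
    by (cases rule: transposition_cases[where x = y and \<alpha> = \<alpha> and \<beta> = \<beta>])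
      (auto simp: transposition_fix transposition_app1 transposition_app2 carries_def app_mult)
  then show ?case
    using step by (simp add: act_add pfx_add pfx_tr act_tr)
qed simp

lemma carries_pfx_perp:
  assumes "\<eta> \<bottom>\<^sub>a \<zeta>"
  shows "carries (act (pfx \<zeta> p)) \<eta> \<eta>"
proof (induction p rule: nV_pres_induct)
  case zero
  then show ?case by (simp add: carries_def)
next
  case (step p \<alpha> \<beta>)
  have "\<eta> \<bottom>\<^sub>a \<zeta> \<cdot>\<^sub>a \<alpha>" "\<eta> \<bottom>\<^sub>a \<zeta> \<cdot>\<^sub>a \<beta>"
    using assms perp_extend_left perp_sym by blast+
  with step show ?case
    unfolding pfx_add pfx_tr act_add
    by (intro carries_comp[OF step.IH]) (simp add: act_tr carries_transposition)
qed

section \<open>Conjugation in the presented group\<close>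

text \<open>
  A map is conewise at \<open>L\<close> if it exchanges prefixes on all addresses of shape at least \<open>L\<close>; for
  bijections, having some such \<open>L\<close> will turn out to be membership in nV.
\<close>

definition conewise :: "('n cantor \<Rightarrow> 'n cantor) \<Rightarrow> ('n \<Rightarrow> nat) \<Rightarrow> bool"
  where "conewise g L \<longleftrightarrow> (\<forall>\<gamma>. L \<le> alen \<gamma> \<longrightarrow> (\<exists>\<gamma>'. carries g \<gamma> \<gamma>'))"

lemma conewise_imageE:
  assumes "conewise g L" "(\<lambda>d. L d + M d) \<le> alen \<gamma>"
  obtains \<gamma>' where "carries g \<gamma> \<gamma>'" "M \<le> alen \<gamma>'"
proof -
  obtain \<alpha> \<delta> where d: "\<gamma> = \<alpha> \<cdot>\<^sub>a \<delta>" "alen \<alpha> = L" "M \<le> alen \<delta>"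
    using assms(2) by (rule deep_decompose)
  obtain \<alpha>' where "carries g \<alpha> \<alpha>'"
    using assms(1) d(2) unfolding conewise_def by blast
  then have "carries g \<gamma> (\<alpha>' \<cdot>\<^sub>a \<delta>)"
    using d(1) carries_mult by blast
  moreover have "M \<le> alen (\<alpha>' \<cdot>\<^sub>a \<delta>)"
    using d(3) by (simp add: alen_mult le_fun_def trans_le_add2)
  ultimately show ?thesis by (rule that)
qed

lemma alen_bounds:
  assumes "(\<lambda>d. alen \<alpha> d + alen \<beta> d) \<le> alen \<gamma>"
  shows "alen \<alpha> \<le> alen \<gamma>" "alen \<beta> \<le> alen \<gamma>"
  using assms by (auto simp: le_fun_def intro: add_leD1 add_leD2)

text \<open>
  On sufficiently long addresses the letters of a word for \<open>p\<close> act one after the other without ever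
  being undefined, so the second relation can be applied letter by letter.
\<close>

lemma tr_conj_deep:
  "\<exists>L. conewise (act p) L \<and> (\<forall>\<gamma> \<delta> \<gamma>' \<delta>'. L \<le> alen \<gamma> \<longrightarrow> L \<le> alen \<delta> \<longrightarrow> \<gamma> \<bottom>\<^sub>a \<delta> \<longrightarrow>
    carries (act p) \<gamma> \<gamma>' \<longrightarrow> carries (act p) \<delta> \<delta>' \<longrightarrow> - p + tr \<gamma> \<delta> + p = tr \<gamma>' \<delta>')"
proof (induction p rule: nV_pres_induct)
  case zero
  have "carries (act 0) \<gamma> \<gamma>' \<longleftrightarrow> \<gamma> = \<gamma>'" for \<gamma> \<gamma>' :: "'a address"
    by (simp only: act_zero carries_id)
  then show ?case
    by (auto simp: conewise_def)
next
  case (step p \<alpha> \<beta>)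
  let ?t = "tr \<alpha> \<beta>" and ?M = "\<lambda>d. alen \<alpha> d + alen \<beta> d"
  obtain L where L: "conewise (act p) L" and IH: "\<And>\<gamma> \<delta> \<gamma>' \<delta>'. L \<le> alen \<gamma> \<Longrightarrow> L \<le> alen \<delta> \<Longrightarrow> \<gamma> \<bottom>\<^sub>a \<delta> \<Longrightarrow>
    carries (act p) \<gamma> \<gamma>' \<Longrightarrow> carries (act p) \<delta> \<delta>' \<Longrightarrow> - p + tr \<gamma> \<delta> + p = tr \<gamma>' \<delta>'"
    using step.IH by blast
  \<comment> \<open>Length L makes p act; the extra ?M survives under p and makes the last letter act.\<close>
  define N where "N = (\<lambda>d. L d + ?M d)"
  have image: "\<exists>\<gamma>1 \<gamma>2. carries (act p) \<gamma> \<gamma>1 \<and> \<gamma>1 \<bullet>\<^sub>a (\<alpha>, \<beta>) = Some \<gamma>2 \<and> carries (act (p + ?t)) \<gamma> \<gamma>2"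
    if N: "N \<le> alen \<gamma>" for \<gamma>
  proof -
    obtain \<gamma>1 where 1: "carries (act p) \<gamma> \<gamma>1" "?M \<le> alen \<gamma>1"
      using conewise_imageE[OF L N[unfolded N_def]] by blast
    then obtain \<gamma>2 where 2: "\<gamma>1 \<bullet>\<^sub>a (\<alpha>, \<beta>) = Some \<gamma>2"
      using addr_act_deep alen_bounds by blast
    then have "carries (act (p + ?t)) \<gamma> \<gamma>2"
      unfolding act_add act_tr[OF step.hyps] using 1(1) addr_act_carries carries_comp step.hyps by blast
    then show ?thesis using 1 2 by blast
  qed
  have "- (p + ?t) + tr \<gamma> \<delta> + (p + ?t) = tr \<gamma>' \<delta>'"
    if h: "N \<le> alen \<gamma>" "N \<le> alen \<delta>" "\<gamma> \<bottom>\<^sub>a \<delta>" "carries (act (p + ?t)) \<gamma> \<gamma>'" "carries (act (p + ?t)) \<delta> \<delta>'"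
    for \<gamma> \<delta> \<gamma>' \<delta>'
  proof -
    obtain \<gamma>1 where g: "carries (act p) \<gamma> \<gamma>1" "\<gamma>1 \<bullet>\<^sub>a (\<alpha>, \<beta>) = Some \<gamma>'"
      using image[OF h(1)] h(4) carries_unique by blast
    obtain \<delta>1 where d: "carries (act p) \<delta> \<delta>1" "\<delta>1 \<bullet>\<^sub>a (\<alpha>, \<beta>) = Some \<delta>'"
      using image[OF h(2)] h(5) carries_unique by blast
    have "L \<le> N"
      by (simp add: N_def le_fun_def)
    then have "- p + tr \<gamma> \<delta> + p = tr \<gamma>1 \<delta>1"
      using IH h(1-3) g(1) d(1) by (meson order_trans)
    moreover have "- ?t + tr \<gamma>1 \<delta>1 + ?t = tr \<gamma>' \<delta>'"
      using tr_conj step.hyps g(2) d(2) carries_perp[OF inj_act g(1) d(1) h(3)] by blast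
    moreover have "- (p + ?t) + tr \<gamma> \<delta> + (p + ?t) = - ?t + (- p + tr \<gamma> \<delta> + p) + ?t"
      by (simp only: minus_add add.assoc)
    ultimately show ?thesis by simp
  qed
  moreover have "conewise (act (p + ?t)) N"
    using image unfolding conewise_def by blast
  ultimately show ?case by blast
qed

lemma conewise_act: "\<exists>L. conewise (act p) L"
  using tr_conj_deep by blast

lemma conj_add: "- p + (x + y) + p = (- p + x + p) + (- p + y + p)" for p :: "'a::group_add"
  by (simp add: add.assoc)

lemma conj_eq_iff: "- p + x + p = y \<longleftrightarrow> x + p = p + y" for p :: "'a::group_add"
  by (metis add.assoc add_minus_cancel minus_add_cancel)

text \<open>
  Conjugation in \<open>P\<close> is determined by the action. The word of \<open>p\<close> need not act letter by letter on
  \<open>\<alpha>\<close> and \<open>\<beta>\<close> themselves, but it does so on long extensions, and the third relation reassembles the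
  generator from these.
\<close>

lemma tr_conj_carries:
  fixes p :: "'n::finite nV_pres"
  assumes "carries (act p) \<alpha> \<alpha>'" "carries (act p) \<beta> \<beta>'" "\<alpha> \<bottom>\<^sub>a \<beta>"
  shows "- p + tr \<alpha> \<beta> + p = tr \<alpha>' \<beta>'"
proof -
  obtain L where L: "\<And>\<gamma> \<delta> \<gamma>' \<delta>'. L \<le> alen \<gamma> \<Longrightarrow> L \<le> alen \<delta> \<Longrightarrow> \<gamma> \<bottom>\<^sub>a \<delta> \<Longrightarrow>
    carries (act p) \<gamma> \<gamma>' \<Longrightarrow> carries (act p) \<delta> \<delta>' \<Longrightarrow> - p + tr \<gamma> \<delta> + p = tr \<gamma>' \<delta>'"
    using tr_conj_deep[of p] by blast
  have "- p + tr (\<alpha> \<cdot>\<^sub>a root) (\<beta> \<cdot>\<^sub>a root) + p = tr (\<alpha>' \<cdot>\<^sub>a root) (\<beta>' \<cdot>\<^sub>a root)"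
  proof (rule split_induct[where L = L and Q = "\<lambda>\<delta>. - p + tr (\<alpha> \<cdot>\<^sub>a \<delta>) (\<beta> \<cdot>\<^sub>a \<delta>) + p = tr (\<alpha>' \<cdot>\<^sub>a \<delta>) (\<beta>' \<cdot>\<^sub>a \<delta>)"])
    fix \<delta> :: "'n address"
    assume level: "alen \<delta> = L"
    show "- p + tr (\<alpha> \<cdot>\<^sub>a \<delta>) (\<beta> \<cdot>\<^sub>a \<delta>) + p = tr (\<alpha>' \<cdot>\<^sub>a \<delta>) (\<beta>' \<cdot>\<^sub>a \<delta>)"
    proof (rule L)
      show "L \<le> alen (\<alpha> \<cdot>\<^sub>a \<delta>)" "L \<le> alen (\<beta> \<cdot>\<^sub>a \<delta>)"
        using level by (auto simp: alen_mult le_fun_def)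
    qed (use assms in \<open>auto intro: carries_mult perp_extend\<close>)
  next
    fix \<delta> :: "'n address" and d
    assume split: "- p + tr (\<alpha> \<cdot>\<^sub>a \<delta> \<cdot>\<^sub>a digit False d) (\<beta> \<cdot>\<^sub>a \<delta> \<cdot>\<^sub>a digit False d) + p
        = tr (\<alpha>' \<cdot>\<^sub>a \<delta> \<cdot>\<^sub>a digit False d) (\<beta>' \<cdot>\<^sub>a \<delta> \<cdot>\<^sub>a digit False d)"
      "- p + tr (\<alpha> \<cdot>\<^sub>a \<delta> \<cdot>\<^sub>a digit True d) (\<beta> \<cdot>\<^sub>a \<delta> \<cdot>\<^sub>a digit True d) + p
        = tr (\<alpha>' \<cdot>\<^sub>a \<delta> \<cdot>\<^sub>a digit True d) (\<beta>' \<cdot>\<^sub>a \<delta> \<cdot>\<^sub>a digit True d)"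
    have "\<alpha>' \<bottom>\<^sub>a \<beta>'"
      using carries_perp[OF inj_act] assms by blast
    then show "- p + tr (\<alpha> \<cdot>\<^sub>a \<delta>) (\<beta> \<cdot>\<^sub>a \<delta>) + p = tr (\<alpha>' \<cdot>\<^sub>a \<delta>) (\<beta>' \<cdot>\<^sub>a \<delta>)"
      using tr_split[OF perp_extend, of \<alpha> \<beta> \<delta> \<delta> d] tr_split[OF perp_extend, of \<alpha>' \<beta>' \<delta> \<delta> d] assms(3)
      by (simp only: split conj_add addr_mult_assoc)
  qed
  then show ?thesis by simp
qed

text \<open>
  Conjugate the generator by itself.
\<close>

lemma tr_sym: "tr \<alpha> \<beta> = tr \<beta> \<alpha>" for \<alpha> :: "'n::finite address"
proof (cases "\<alpha> \<bottom>\<^sub>a \<beta>")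
  case True
  then have "- tr \<alpha> \<beta> + tr \<alpha> \<beta> + tr \<alpha> \<beta> = tr \<beta> \<alpha>"
    by (intro tr_conj_carries) (auto simp: act_tr intro: carries_transposition)
  then show ?thesis by (simp del: uminus_tr)
next
  case False
  then have "\<not> \<beta> \<bottom>\<^sub>a \<alpha>"
    by (simp add: perp_sym[of \<beta>])
  with False show ?thesis by simp
qed

lemma pfx_conj_carries:
  fixes p :: "'n::finite nV_pres"
  assumes "carries (act p) \<alpha> \<beta>"
  shows "- p + pfx \<alpha> q + p = pfx \<beta> q"
proof (induction q rule: nV_pres_induct)
  case (step q \<gamma> \<delta>)
  have "- p + tr (\<alpha> \<cdot>\<^sub>a \<gamma>) (\<alpha> \<cdot>\<^sub>a \<delta>) + p = tr (\<beta> \<cdot>\<^sub>a \<gamma>) (\<beta> \<cdot>\<^sub>a \<delta>)"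
    using assms step.hyps by (intro tr_conj_carries carries_mult) auto
  with step show ?case
    by (simp only: pfx_add pfx_tr conj_add)
qed simp

text \<open>
  An element of the kernel carries every address to itself, so it commutes with every generator.
\<close>

lemma kernel_central:
  fixes k :: "'n::finite nV_pres"
  assumes "act k = id"
  shows "k + q = q + k"
proof (induction q rule: nV_pres_induct)
  case (step q \<alpha> \<beta>)
  have "- k + tr \<alpha> \<beta> + k = tr \<alpha> \<beta>"
    using step.hyps assms by (intro tr_conj_carries) auto
  then have "tr \<alpha> \<beta> + k = k + tr \<alpha> \<beta>"
    by (simp only: conj_eq_iff)
  with step.IH show ?case
    by (metis add.assoc)
qed simp

section \<open>Length-preserving elements\<close>

text \<open>
  For a finite antichain \<open>A\<close> this is a copy of the symmetric group on \<open>A\<close>, generated by all its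
  transpositions, because it acts faithfully (\<open>symgen_faithful\<close>).
\<close>

inductive_set symgen :: "'n address set \<Rightarrow> 'n nV_pres set" for A where
  zero: "0 \<in> symgen A"
| step: "p \<in> symgen A \<Longrightarrow> \<alpha> \<in> A \<Longrightarrow> \<beta> \<in> A \<Longrightarrow> \<alpha> \<bottom>\<^sub>a \<beta> \<Longrightarrow> p + tr \<alpha> \<beta> \<in> symgen A"

lemma symgen_tr: "\<alpha> \<in> A \<Longrightarrow> \<beta> \<in> A \<Longrightarrow> tr \<alpha> \<beta> \<in> symgen A"
  using symgen.step[OF symgen.zero] symgen.zero by (cases "\<alpha> \<bottom>\<^sub>a \<beta>") fastforce+

lemma symgen_add: "q \<in> symgen A \<Longrightarrow> p \<in> symgen A \<Longrightarrow> p + q \<in> symgen A"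
  by (induction rule: symgen.induct) (auto simp: add.assoc[symmetric] intro: symgen.step)

lemma symgen_uminus: "p \<in> symgen A \<Longrightarrow> - p \<in> symgen A"
proof (induction rule: symgen.induct)
  case (step p \<alpha> \<beta>)
  then have "tr \<alpha> \<beta> + - p \<in> symgen A"
    by (intro symgen_add symgen_tr) auto
  then show ?case
    by (simp only: minus_add uminus_tr)
qed (simp add: symgen.zero)

lemma symgen_fix:
  assumes "p \<in> symgen A" "\<And>\<alpha>. \<alpha> \<in> A \<Longrightarrow> \<gamma> \<bottom>\<^sub>a \<alpha>"
  shows "carries (act p) \<gamma> \<gamma>"
  using assms(1)
proof (induction rule: symgen.induct)
  case (step p \<alpha> \<beta>)
  then show ?case
    unfolding act_add act_tr[OF step.hyps(4)]
    using assms(2) by (intro carries_comp[OF step.IH] carries_transposition)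
qed (simp add: carries_def)

lemma symgen_permutes:
  assumes "p \<in> symgen A" "pairwise addr_perp A" "\<delta> \<in> A"
  shows "\<exists>\<epsilon>\<in>A. carries (act p) \<epsilon> \<delta>"
  using assms(1,3)
proof (induction arbitrary: \<delta> rule: symgen.induct)
  case (step p \<alpha> \<beta>)
  have "\<exists>\<eta>\<in>A. carries (transposition \<alpha> \<beta>) \<eta> \<delta>"
  proof (cases "\<delta> = \<alpha> \<or> \<delta> = \<beta>")
    case False
    then show ?thesis
      using carries_transposition(3)[OF step.hyps(4), of \<delta>] step.hyps step.prems assms(2)
      unfolding pairwise_def by (intro bexI[of _ \<delta>]) auto
  qed (use step.hyps(2,3) carries_transposition(1,2)[OF step.hyps(4)] in blast)
  then show ?case
    unfolding act_add act_tr[OF step.hyps(4)] using step.IH carries_comp by blast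
qed (auto simp: carries_def)

text \<open>
  The coset decomposition of the symmetric group on \<open>insert c A\<close> with respect to the stabiliser of
  \<open>c\<close>. The right-hand side contains 0 and is closed under right multiplication by transpositions,
  because a transposition that moves \<open>c\<close> can be pulled to the left by conjugation.
\<close>

lemma symgen_decompose:
  fixes A :: "'n::finite address set"
  assumes x: "x \<in> symgen (insert c A)" and A: "pairwise addr_perp (insert c A)" "c \<notin> A"
  shows "x \<in> symgen A \<or> (\<exists>b\<in>A. \<exists>y\<in>symgen A. x = tr c b + y)"
  using x
proof (induction rule: symgen.induct)
  case zero
  then show ?case by (simp add: symgen.zero)
next
  case (step x \<alpha> \<beta>)
  have cA: "c \<bottom>\<^sub>a a" if "a \<in> A" for a
    using that A by (auto simp: pairwise_insert)
  have pA: "pairwise addr_perp A"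
    using A(1) by (simp add: pairwise_insert)
  have move: "\<exists>e\<in>A. y + tr c b = tr c e + y" if yb: "y \<in> symgen A" "b \<in> A" for y b
  proof -
    obtain e where e: "e \<in> A" "carries (act y) e b"
      using symgen_permutes[OF yb(1) pA yb(2)] by blast
    have "- y + tr c e + y = tr c b"
      by (intro tr_conj_carries symgen_fix[OF yb(1)] cA e)
    then show ?thesis
      using e(1) unfolding conj_eq_iff by metis
  qed
  have main: "x + tr c b \<in> symgen A \<or> (\<exists>b'\<in>A. \<exists>y\<in>symgen A. x + tr c b = tr c b' + y)"
    if b: "b \<in> A" for b
    using step.IH
  proof
    assume "x \<in> symgen A"
    then show ?thesis using move[OF _ b] by blast
  next
    assume "\<exists>b\<in>A. \<exists>y\<in>symgen A. x = tr c b + y"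
    then obtain f y where f: "f \<in> A" "y \<in> symgen A" "x = tr c f + y"
      by blast
    obtain e where e: "e \<in> A" "y + tr c b = tr c e + y"
      using move[OF f(2) b] by blast
    have eq: "x + tr c b = tr c f + tr c e + y"
      using e(2) by (simp add: f(3) add.assoc)
    show ?thesis
    proof (cases "e = f")
      case True
      then show ?thesis using eq f(2) by simp
    next
      case False
      then have "f \<bottom>\<^sub>a e"
        using pairwiseD[OF pA f(1) e(1)] by simp
      then have "- tr c e + tr c f + tr c e = tr e f"
        using carries_transposition[OF cA[OF e(1)]] cA[OF f(1)] cA[OF e(1)] perp_sym[of f c]
        by (intro tr_conj_carries) (simp_all add: act_tr)
      then have "x + tr c b = tr c e + (tr e f + y)"
        unfolding eq conj_eq_iff by (simp only: add.assoc)
      then show ?thesis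
        using e(1) f(1,2) symgen_add symgen_tr by blast
    qed
  qed
  show ?case
  proof (cases "\<alpha> = c \<or> \<beta> = c")
    case True
    then show ?thesis
      using main step.hyps by (metis insertE perp_irrefl tr_sym)
  next
    case False
    then have "tr \<alpha> \<beta> \<in> symgen A"
      using step.hyps by (auto intro: symgen_tr)
    then show ?thesis
      using step.IH symgen_add by (metis add.assoc)
  qed
qed

text \<open>
  An element \<open>tr c b + y\<close> of the decomposition moves \<open>c\<close> into \<open>A\<close>, so an element that acts trivially
  already lies in the symmetric group on \<open>A\<close>.
\<close>

lemma symgen_faithful:
  fixes A :: "'n::finite address set"
  assumes "finite A" "pairwise addr_perp A" "x \<in> symgen A" "act x = id"
  shows "x = 0"
  using assms
proof (induction A arbitrary: x rule: finite_induct)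
  case empty
  from empty(2) show ?case
    by (cases rule: symgen.cases) auto
next
  case (insert c A)
  have pA: "pairwise addr_perp A" and cA: "\<And>a. a \<in> A \<Longrightarrow> c \<bottom>\<^sub>a a"
    using insert.prems(1) insert.hyps(2) by (auto simp: pairwise_insert)
  have "x \<in> symgen A"
  proof (rule ccontr)
    assume "x \<notin> symgen A"
    then obtain b y where b: "b \<in> A" and y: "y \<in> symgen A" "x = tr c b + y"
      using symgen_decompose[OF insert.prems(2,1) insert.hyps(2)] by blast
    obtain e where e: "e \<in> A" "carries (act (- y)) e b"
      using symgen_permutes[OF symgen_uminus[OF y(1)] pA b] by blast
    have "carries (act y) b e"
      using e(2) act_uminus(2)[of y] unfolding carries_def by metis
    then have "carries (act x) c e"
      unfolding y(2) act_add using cA[OF b]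
      by (intro carries_comp[of _ c b]) (simp_all add: act_tr carries_transposition)
    then have "c = e"
      using insert.prems(3) by (simp only: carries_id)
    then show False
      using e(1) insert.hyps(2) by simp
  qed
  then show ?case
    using insert.IH pA insert.prems(3) by blast
qed

text \<open>
  The subgroup of length-preserving elements. By the third relation, each of its elements lies in the
  symmetric group on a level, that is, on all addresses of one shape.
\<close>

inductive_set lenpres :: "'n nV_pres set" where
  zero: "0 \<in> lenpres"
| step: "p \<in> lenpres \<Longrightarrow> \<alpha> \<bottom>\<^sub>a \<beta> \<Longrightarrow> alen \<alpha> = alen \<beta> \<Longrightarrow> p + tr \<alpha> \<beta> \<in> lenpres"

lemma lenpres_tr: "alen \<alpha> = alen \<beta> \<Longrightarrow> tr \<alpha> \<beta> \<in> lenpres"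
  using lenpres.step[OF lenpres.zero] lenpres.zero by (cases "\<alpha> \<bottom>\<^sub>a \<beta>") fastforce+

lemma lenpres_add: "q \<in> lenpres \<Longrightarrow> p \<in> lenpres \<Longrightarrow> p + q \<in> lenpres"
  by (induction rule: lenpres.induct) (auto simp: add.assoc[symmetric] intro: lenpres.step)

lemma lenpres_uminus: "p \<in> lenpres \<Longrightarrow> - p \<in> lenpres"
proof (induction rule: lenpres.induct)
  case (step p \<alpha> \<beta>)
  then have "tr \<alpha> \<beta> + - p \<in> lenpres"
    by (intro lenpres_add lenpres_tr) auto
  then show ?case
    by (simp only: minus_add uminus_tr)
qed (simp add: lenpres.zero)

lemma tr_symgen_level:
  fixes \<alpha> \<beta> :: "'n::finite address"
  assumes "alen \<alpha> = alen \<beta>" "alen \<alpha> \<le> N" "\<alpha> \<bottom>\<^sub>a \<beta>"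
  shows "tr \<alpha> \<beta> \<in> symgen (level N)"
proof -
  have "tr (\<alpha> \<cdot>\<^sub>a root) (\<beta> \<cdot>\<^sub>a root) \<in> symgen (level N)"
  proof (rule split_induct[where Q = "\<lambda>\<delta>. tr (\<alpha> \<cdot>\<^sub>a \<delta>) (\<beta> \<cdot>\<^sub>a \<delta>) \<in> symgen (level N)"])
    fix \<delta> :: "'n address"
    assume "alen \<delta> = (\<lambda>d. N d - alen \<alpha> d)"
    then show "tr (\<alpha> \<cdot>\<^sub>a \<delta>) (\<beta> \<cdot>\<^sub>a \<delta>) \<in> symgen (level N)"
      using assms by (intro symgen_tr) (auto simp: level_def alen_mult le_fun_def)
  next
    fix \<delta> :: "'n address" and d
    assume "tr (\<alpha> \<cdot>\<^sub>a \<delta> \<cdot>\<^sub>a digit False d) (\<beta> \<cdot>\<^sub>a \<delta> \<cdot>\<^sub>a digit False d) \<in> symgen (level N)"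
      "tr (\<alpha> \<cdot>\<^sub>a \<delta> \<cdot>\<^sub>a digit True d) (\<beta> \<cdot>\<^sub>a \<delta> \<cdot>\<^sub>a digit True d) \<in> symgen (level N)"
    then show "tr (\<alpha> \<cdot>\<^sub>a \<delta>) (\<beta> \<cdot>\<^sub>a \<delta>) \<in> symgen (level N)"
      using tr_split[OF perp_extend[OF assms(3)], of \<delta> \<delta> d] by (simp add: addr_mult_assoc symgen_add)
  qed
  then show ?thesis by simp
qed

lemma lenpres_symgen:
  fixes p :: "'n::finite nV_pres"
  assumes "p \<in> lenpres"
  shows "\<exists>L. \<forall>N\<ge>L. p \<in> symgen (level N)"
  using assms
proof (induction rule: lenpres.induct)
  case zero
  then show ?case by (simp add: symgen.zero)
next
  case (step p \<alpha> \<beta>)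
  then obtain L where L: "\<And>N. L \<le> N \<Longrightarrow> p \<in> symgen (level N)" by blast
  have "p + tr \<alpha> \<beta> \<in> symgen (level N)" if "(\<lambda>d. L d + alen \<alpha> d) \<le> N" for N
  proof (rule symgen_add)
    have "L \<le> N" "alen \<alpha> \<le> N"
      using that by (auto simp: le_fun_def intro: add_leD1 add_leD2)
    then show "p \<in> symgen (level N)" "tr \<alpha> \<beta> \<in> symgen (level N)"
      using L tr_symgen_level[OF step.hyps(3) _ step.hyps(2)] by auto
  qed
  then show ?case by blast
qed

lemma lenpres_faithful:
  fixes p q :: "'n::finite nV_pres"
  assumes "p \<in> lenpres" "q \<in> lenpres" "act p = act q"
  shows "p = q"
proof -
  have "p + - q \<in> lenpres"
    using assms by (intro lenpres_add lenpres_uminus)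
  then obtain L where "p + - q \<in> symgen (level L)"
    using lenpres_symgen by blast
  moreover have "act (p + - q) = id"
    unfolding act_add assms(3) using act_uminus(1)[of q] by (intro ext) (simp only: o_apply id_apply)
  moreover have "pairwise addr_perp (level L)"
    unfolding pairwise_def using level_perp by blast
  ultimately have "p + - q = 0"
    using symgen_faithful finite_level by blast
  then show ?thesis
    by (simp add: add_eq_0_iff2)
qed

lemma lenpres_permutation:
  fixes \<sigma> :: "'n::finite address \<Rightarrow> 'n address"
  assumes "\<sigma> permutes level N"
  shows "\<exists>p\<in>lenpres. \<forall>\<alpha>\<in>level N. carries (act p) \<alpha> (\<sigma> \<alpha>)"
  using assms finite_level
proof (induction rule: permutes_induct)
  case id
  show ?case
    by (rule bexI[OF _ lenpres.zero]) simp
next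
  case (swap a b \<sigma>)
  then obtain p where p: "p \<in> lenpres" "\<And>\<alpha>. \<alpha> \<in> level N \<Longrightarrow> carries (act p) \<alpha> (\<sigma> \<alpha>)"
    by blast
  have ab: "a \<bottom>\<^sub>a b"
    using swap level_perp by blast
  have "p + tr a b \<in> lenpres"
    using p(1) swap by (intro lenpres_add lenpres_tr) (auto simp: level_def)
  moreover have "carries (act (p + tr a b)) \<alpha> ((Transposition.transpose a b \<circ> \<sigma>) \<alpha>)"
    if \<alpha>: "\<alpha> \<in> level N" for \<alpha>
  proof -
    have s: "\<sigma> \<alpha> \<in> level N"
      using swap \<alpha> by (metis permutes_in_image)
    then have "carries (transposition a b) (\<sigma> \<alpha>) (Transposition.transpose a b (\<sigma> \<alpha>))"
      using carries_transposition[OF ab] level_perp[OF s swap(1)] level_perp[OF s swap(2)]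
      by (cases "\<sigma> \<alpha> = a"; cases "\<sigma> \<alpha> = b") auto
    then show ?thesis
      unfolding act_add act_tr[OF ab] using carries_comp[OF p(2)[OF \<alpha>]] by simp
  qed
  ultimately show ?case by blast
qed

section \<open>Partitions\<close>

definition addr_partition :: "'n address set \<Rightarrow> bool"
  where "addr_partition A \<longleftrightarrow> finite A \<and> pairwise addr_perp A \<and> (\<forall>x. \<exists>\<alpha>\<in>A. x \<in> cylinder \<alpha>)"

definition split_at :: "'n address set \<Rightarrow> 'n address \<Rightarrow> 'n \<Rightarrow> 'n address set"
  where "split_at A \<alpha> d = (A - {\<alpha>}) \<union> {\<alpha> \<cdot>\<^sub>a digit False d, \<alpha> \<cdot>\<^sub>a digit True d}"

lemma addr_partition_root: "addr_partition {root}"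
  by (auto simp: addr_partition_def cylinder_iff)

lemma addr_partition_level: "addr_partition (level (L :: 'n::finite \<Rightarrow> nat))"
  unfolding addr_partition_def pairwise_def using finite_level level_cover level_perp by blast

lemma addr_partition_split_at:
  assumes "addr_partition A" "\<alpha> \<in> A"
  shows "addr_partition (split_at A \<alpha> d)"
proof -
  have A: "finite A" "pairwise addr_perp A" "\<And>x. \<exists>\<alpha>\<in>A. x \<in> cylinder \<alpha>"
    using assms(1) by (auto simp: addr_partition_def)
  have perp: "\<beta> \<bottom>\<^sub>a \<alpha>" "\<beta> \<bottom>\<^sub>a \<alpha> \<cdot>\<^sub>a \<delta>" "\<alpha> \<cdot>\<^sub>a \<delta> \<bottom>\<^sub>a \<beta>" if "\<beta> \<in> A" "\<beta> \<noteq> \<alpha>" for \<beta> \<delta>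
    using pairwiseD[OF A(2) that(1) assms(2) that(2)] perp_extend_left perp_sym by blast+
  have "pairwise addr_perp (split_at A \<alpha> d)"
    using A(2) perp perp_digits[of d] perp_digits_sym[of d]
    unfolding split_at_def pairwise_def by auto
  moreover have "\<exists>\<beta>\<in>split_at A \<alpha> d. x \<in> cylinder \<beta>" for x
  proof -
    obtain \<beta> where \<beta>: "\<beta> \<in> A" "x \<in> cylinder \<beta>"
      using A(3) by blast
    show ?thesis
    proof (cases "\<beta> = \<alpha>")
      case True
      obtain y where y: "x = \<alpha> \<frown>\<^sub>a y"
        using \<beta>(2) True by (metis in_cylinderE)
      obtain u w where "y = digit u d \<frown>\<^sub>a w"
        using digit_cover[of y d] by blast
      then have "x \<in> cylinder (\<alpha> \<cdot>\<^sub>a digit u d)"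
        by (simp add: y flip: app_mult)
      then show ?thesis
        by (cases u) (auto simp: split_at_def)
    qed (use \<beta> in \<open>auto simp: split_at_def\<close>)
  qed
  ultimately show ?thesis
    using A(1) by (simp add: addr_partition_def split_at_def)
qed

lemma partition_eq_level:
  fixes A :: "'n::finite address set"
  assumes "addr_partition A" "A \<subseteq> level N"
  shows "A = level N"
proof
  show "level N \<subseteq> A"
  proof
    fix \<beta> assume \<beta>: "\<beta> \<in> level N"
    obtain \<alpha> where \<alpha>: "\<alpha> \<in> A" "\<beta> \<frown>\<^sub>a undefined \<in> cylinder \<alpha>"
      using assms(1) unfolding addr_partition_def by blast
    then have "\<not> \<alpha> \<bottom>\<^sub>a \<beta>"
      unfolding perp_iff_disjoint using app_in_cylinder by blast
    then show "\<beta> \<in> A"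
      using level_perp \<alpha>(1) \<beta> assms(2) by blast
  qed
qed (rule assms(2))

text \<open>
  Every partition is refined to a level by splitting one member at a time. The measure gives a member
  the weight 3 to the number of digits that it lacks, so a split replaces one weight by two of
  at most a third of it.
\<close>

lemma partition_refine_induct [consumes 2]:
  fixes A :: "'n::finite address set"
  assumes "addr_partition A" "\<And>\<alpha>. \<alpha> \<in> A \<Longrightarrow> alen \<alpha> \<le> N"
    and level: "Q (level N)"
    and split: "\<And>A \<alpha> d. addr_partition A \<Longrightarrow> \<alpha> \<in> A \<Longrightarrow> Q (split_at A \<alpha> d) \<Longrightarrow> Q A"
  shows "Q A"
  using assms(1,2)
proof (induction "\<Sum>\<alpha>\<in>A. (3::nat) ^ (\<Sum>d\<in>UNIV. N d - alen \<alpha> d)" arbitrary: A rule: less_induct)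
  case less
  define m where "m = (\<lambda>\<alpha> :: 'n address. (3::nat) ^ (\<Sum>d\<in>UNIV. N d - alen \<alpha> d))"
  show ?case
  proof (cases "A \<subseteq> level N")
    case True
    then show ?thesis
      using level partition_eq_level less.prems(1) by metis
  next
    case False
    then obtain \<alpha> where \<alpha>: "\<alpha> \<in> A" "alen \<alpha> \<noteq> N"
      by (auto simp: level_def)
    then obtain d where d: "alen \<alpha> d < N d"
      using less.prems(2)[OF \<alpha>(1)] by (metis le_funD order.not_eq_order_implies_strict ext)
    let ?B = "split_at A \<alpha> d"
    have fin: "finite A"
      using less.prems(1) by (simp add: addr_partition_def)
    have child: "m (\<alpha> \<cdot>\<^sub>a digit u d) * 3 \<le> m \<alpha>" for u
    proof -
      have "(\<Sum>e\<in>UNIV. N e - alen (\<alpha> \<cdot>\<^sub>a digit u d) e) < (\<Sum>e\<in>UNIV. N e - alen \<alpha> e)"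
        using d by (intro sum_strict_mono_ex1) (auto simp: alen_mult alen_digit intro!: exI[of _ d])
      then show ?thesis
        using power_increasing[of "Suc (\<Sum>e\<in>UNIV. N e - alen (\<alpha> \<cdot>\<^sub>a digit u d) e)"
            "\<Sum>e\<in>UNIV. N e - alen \<alpha> e" "3::nat"] by (simp add: m_def)
    qed
    have "sum m ?B \<le> sum m (A - {\<alpha>}) + sum m {\<alpha> \<cdot>\<^sub>a digit False d, \<alpha> \<cdot>\<^sub>a digit True d}"
      unfolding split_at_def
      using sum.union_inter[of "A - {\<alpha>}" "{\<alpha> \<cdot>\<^sub>a digit False d, \<alpha> \<cdot>\<^sub>a digit True d}" m] fin by simp
    also have "sum m {\<alpha> \<cdot>\<^sub>a digit False d, \<alpha> \<cdot>\<^sub>a digit True d} \<le> m (\<alpha> \<cdot>\<^sub>a digit False d) + m (\<alpha> \<cdot>\<^sub>a digit True d)"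
      by (simp add: sum.insert_if)
    also have "\<dots> < m \<alpha>"
    proof -
      have "0 < m \<alpha>" by (simp add: m_def)
      then show ?thesis using child[of False] child[of True] by linarith
    qed
    finally have "sum m ?B < sum m A"
      using sum.remove[OF fin \<alpha>(1), of m] by simp
    moreover have "alen \<beta> \<le> N" if "\<beta> \<in> ?B" for \<beta>
      using that less.prems(2) \<alpha>(1) d
      by (auto simp: split_at_def alen_mult alen_digit le_fun_def)
    ultimately have "Q ?B"
      using less.hyps[of ?B] addr_partition_split_at[OF less.prems(1) \<alpha>(1)] by (simp add: m_def)
    then show ?thesis
      using split less.prems(1) \<alpha>(1) by blast
  qed
qed

lemma addr_partition_image:
  assumes "addr_partition A" "bij g" "\<And>\<alpha>. \<alpha> \<in> A \<Longrightarrow> carries g \<alpha> (f \<alpha>)"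
  shows "addr_partition (f ` A)"
proof -
  have "pairwise addr_perp (f ` A)"
    using assms carries_perp[OF bij_is_inj[OF assms(2)]]
    unfolding addr_partition_def pairwise_def by (smt (verit) imageE)
  moreover have "\<exists>\<beta>\<in>f ` A. x \<in> cylinder \<beta>" for x
  proof -
    obtain y where y: "x = g y"
      using assms(2) by (metis bij_pointE)
    obtain \<alpha> w where \<alpha>: "\<alpha> \<in> A" "y = \<alpha> \<frown>\<^sub>a w"
      using assms(1) unfolding addr_partition_def by (metis in_cylinderE)
    then have "x = f \<alpha> \<frown>\<^sub>a w"
      using carriesD[OF assms(3)] y by simp
    then show ?thesis
      using \<alpha>(1) by (metis app_in_cylinder image_eqI)
  qed
  ultimately show ?thesis
    using assms(1) by (simp add: addr_partition_def)
qed

section \<open>Rotations\<close>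

text \<open>
  The defining property of the lift \<open>h\<^sub>A\<close>: it moves the digit that follows \<open>\<alpha>\<close> in coordinate \<open>i\<close> to
  the front. Since \<open>\<alpha>\<langle>u\<rangle>\<^sub>i\<close> and \<open>\<langle>u\<rangle>\<^sub>i\<alpha>\<close> have the same shape, a length-preserving element can do
  this.
\<close>

definition rotates :: "'n \<Rightarrow> 'n address set \<Rightarrow> 'n nV_pres \<Rightarrow> bool"
  where "rotates i A p \<longleftrightarrow> p \<in> lenpres \<and>
    (\<forall>\<alpha>\<in>A. \<forall>u. carries (act p) (\<alpha> \<cdot>\<^sub>a digit u i) (digit u i \<cdot>\<^sub>a \<alpha>))"

lemma digit_extract:
  assumes "0 < alen \<delta> i"
  shows "\<exists>u \<epsilon>. \<delta> = digit u i \<cdot>\<^sub>a \<epsilon>"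
proof (intro exI)
  show "\<delta> = digit (hd (\<delta> i)) i \<cdot>\<^sub>a \<delta>(i := tl (\<delta> i))"
    using assms by (auto simp: fun_eq_iff addr_mult_def addr_single_def alen_def)
qed

lemma digit_mult_eq:
  assumes "digit u i \<cdot>\<^sub>a \<alpha> = digit v i \<cdot>\<^sub>a \<beta>"
  shows "u = v" "\<alpha> = \<beta>"
proof -
  show "u = v"
    using fun_cong[OF assms, of i] by (simp add: addr_mult_def addr_single_def)
  then show "\<alpha> = \<beta>"
    using assms by simp
qed

lemma antichain_mult_eq:
  assumes "pairwise addr_perp A" "\<alpha> \<in> A" "\<beta> \<in> A" "\<alpha> \<cdot>\<^sub>a \<delta> = \<beta> \<cdot>\<^sub>a \<epsilon>"
  shows "\<alpha> = \<beta>" "\<delta> = \<epsilon>"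
proof -
  show "\<alpha> = \<beta>"
    using pairwiseD[OF assms(1-3)] perp_extend[of \<alpha> \<beta> \<delta> \<epsilon>] assms(4) by auto
  then show "\<delta> = \<epsilon>"
    using assms(4) by simp
qed

text \<open>
  On a level \<open>N\<close> that is longer than all members of \<open>A\<close>, moving the digit is a permutation of the
  level, and every permutation of a level is induced by a length-preserving element.
\<close>

lemma rotates_exists:
  fixes A :: "'n::finite address set"
  assumes "addr_partition A"
  shows "\<exists>p. rotates i A p"
proof -
  have A: "finite A" "pairwise addr_perp A" "\<And>x. \<exists>\<alpha>\<in>A. x \<in> cylinder \<alpha>"
    using assms by (auto simp: addr_partition_def)
  \<comment> \<open>The successor leaves room for one more digit after each member of the partition.\<close>
  define N where "N = (\<lambda>d. Suc (\<Sum>\<alpha>\<in>A. alen \<alpha> d))"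
  have bound: "alen \<alpha> d < N d" if "\<alpha> \<in> A" for \<alpha> d
    using member_le_sum[of \<alpha> A "\<lambda>\<alpha>. alen \<alpha> d"] A(1) that by (simp add: N_def)
  have "\<exists>t. fst t \<in> A \<and> \<beta> = fst t \<cdot>\<^sub>a digit (fst (snd t)) i \<cdot>\<^sub>a snd (snd t)" if "\<beta> \<in> level N" for \<beta>
  proof -
    obtain \<alpha> where \<alpha>: "\<alpha> \<in> A" "\<beta> \<frown>\<^sub>a undefined \<in> cylinder \<alpha>"
      using A(3) by blast
    then have "\<not> \<alpha> \<bottom>\<^sub>a \<beta>"
      unfolding perp_iff_disjoint using app_in_cylinder by blast
    moreover have "alen \<alpha> \<le> alen \<beta>"
      using that bound[OF \<alpha>(1)] by (auto simp: level_def le_fun_def intro: less_imp_le)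
    ultimately obtain \<epsilon> where \<epsilon>: "\<beta> = \<alpha> \<cdot>\<^sub>a \<epsilon>"
      using comparable_or_perp by blast
    have "alen \<alpha> i + alen \<epsilon> i = N i"
      using that \<epsilon> by (auto simp: level_def alen_mult fun_eq_iff)
    then have pos: "0 < alen \<epsilon> i"
      using bound[OF \<alpha>(1), of i] by linarith
    obtain u \<delta> where "\<epsilon> = digit u i \<cdot>\<^sub>a \<delta>"
      using digit_extract[OF pos] by metis
    then show ?thesis
      using \<epsilon> \<alpha>(1) by (intro exI[of _ "(\<alpha>, u, \<delta>)"]) simp
  qed
  then have "\<forall>\<beta>\<in>level N. \<exists>t. fst t \<in> A \<and> \<beta> = fst t \<cdot>\<^sub>a digit (fst (snd t)) i \<cdot>\<^sub>a snd (snd t)"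
    by blast
  from bchoice[OF this] obtain t where
    t: "\<forall>\<beta>\<in>level N. fst (t \<beta>) \<in> A \<and> \<beta> = fst (t \<beta>) \<cdot>\<^sub>a digit (fst (snd (t \<beta>))) i \<cdot>\<^sub>a snd (snd (t \<beta>))"
    by blast
  define a u e where aue_def: "a = (\<lambda>\<beta>. fst (t \<beta>))" "u = (\<lambda>\<beta>. fst (snd (t \<beta>)))" "e = (\<lambda>\<beta>. snd (snd (t \<beta>)))"
  have aue: "a \<beta> \<in> A" "\<beta> = a \<beta> \<cdot>\<^sub>a digit (u \<beta>) i \<cdot>\<^sub>a e \<beta>" if "\<beta> \<in> level N" for \<beta>
    using bspec[OF t that] unfolding aue_def o_apply by (rule conjunct1, rule conjunct2)
  define \<sigma> where "\<sigma> = (\<lambda>\<beta>. if \<beta> \<in> level N then digit (u \<beta>) i \<cdot>\<^sub>a a \<beta> \<cdot>\<^sub>a e \<beta> else \<beta>)"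
  have inj: "inj_on \<sigma> (level N)"
  proof (rule inj_onI)
    fix \<beta> \<gamma> assume b: "\<beta> \<in> level N" and c: "\<gamma> \<in> level N" and "\<sigma> \<beta> = \<sigma> \<gamma>"
    then have eq: "digit (u \<beta>) i \<cdot>\<^sub>a a \<beta> \<cdot>\<^sub>a e \<beta> = digit (u \<gamma>) i \<cdot>\<^sub>a a \<gamma> \<cdot>\<^sub>a e \<gamma>"
      by (simp add: \<sigma>_def)
    note e1 = digit_mult_eq[OF eq]
    note e2 = antichain_mult_eq[OF A(2) aue(1)[OF b] aue(1)[OF c] e1(2)]
    have "\<beta> = a \<beta> \<cdot>\<^sub>a digit (u \<beta>) i \<cdot>\<^sub>a e \<beta>"
      by (rule aue(2)[OF b])
    also have "\<dots> = a \<gamma> \<cdot>\<^sub>a digit (u \<gamma>) i \<cdot>\<^sub>a e \<gamma>"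
      by (simp only: e1(1) e2)
    also have "\<dots> = \<gamma>"
      by (rule aue(2)[OF c, symmetric])
    finally show "\<beta> = \<gamma>" .
  qed
  have "\<sigma> \<beta> \<in> level N" if "\<beta> \<in> level N" for \<beta>
  proof -
    have "alen (\<sigma> \<beta>) = alen (a \<beta> \<cdot>\<^sub>a digit (u \<beta>) i \<cdot>\<^sub>a e \<beta>)"
      using that by (simp add: \<sigma>_def alen_mult fun_eq_iff)
    then show ?thesis
      using that aue(2)[OF that] by (simp add: level_def)
  qed
  then have "bij_betw \<sigma> (level N) (level N)"
    using inj finite_level endo_inj_surj[of "level N" \<sigma>] by (auto simp: bij_betw_def)
  then have "\<sigma> permutes level N"
    by (rule bij_imp_permutes) (simp add: \<sigma>_def)
  then obtain p where p: "p \<in> lenpres" "\<And>\<beta>. \<beta> \<in> level N \<Longrightarrow> carries (act p) \<beta> (\<sigma> \<beta>)"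
    using lenpres_permutation by blast
  have "carries (act p) (\<alpha> \<cdot>\<^sub>a digit v i) (digit v i \<cdot>\<^sub>a \<alpha>)" if \<alpha>: "\<alpha> \<in> A" for \<alpha> v
  proof -
    have "carries (act p) (\<alpha> \<cdot>\<^sub>a digit v i \<cdot>\<^sub>a root) (digit v i \<cdot>\<^sub>a \<alpha> \<cdot>\<^sub>a root)"
    proof (rule split_induct[where Q = "\<lambda>\<delta>. carries (act p) (\<alpha> \<cdot>\<^sub>a digit v i \<cdot>\<^sub>a \<delta>) (digit v i \<cdot>\<^sub>a \<alpha> \<cdot>\<^sub>a \<delta>)"])
      fix \<delta> :: "'n address"
      assume \<delta>: "alen \<delta> = (\<lambda>d. N d - alen (\<alpha> \<cdot>\<^sub>a digit v i) d)"
      define \<beta> where "\<beta> = \<alpha> \<cdot>\<^sub>a digit v i \<cdot>\<^sub>a \<delta>"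
      have "alen \<beta> d = N d" for d
        using bound[OF \<alpha>, of d] fun_cong[OF \<delta>, of d]
        by (auto simp: \<beta>_def alen_mult alen_digit split: if_splits)
      then have \<beta>: "\<beta> \<in> level N"
        by (auto simp: level_def)
      have eq: "\<alpha> \<cdot>\<^sub>a digit v i \<cdot>\<^sub>a \<delta> = a \<beta> \<cdot>\<^sub>a digit (u \<beta>) i \<cdot>\<^sub>a e \<beta>"
        using aue(2)[OF \<beta>] by (simp add: \<beta>_def)
      have a: "\<alpha> = a \<beta>" "digit v i \<cdot>\<^sub>a \<delta> = digit (u \<beta>) i \<cdot>\<^sub>a e \<beta>"
        using antichain_mult_eq[OF A(2) \<alpha> aue(1)[OF \<beta>] eq] .
      note ve = digit_mult_eq[OF a(2)]
      have "\<sigma> \<beta> = digit (u \<beta>) i \<cdot>\<^sub>a a \<beta> \<cdot>\<^sub>a e \<beta>"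
        using \<beta> by (simp add: \<sigma>_def)
      also have "\<dots> = digit v i \<cdot>\<^sub>a \<alpha> \<cdot>\<^sub>a \<delta>"
        by (simp only: a(1)[symmetric] ve[symmetric])
      finally have sb: "\<sigma> \<beta> = digit v i \<cdot>\<^sub>a \<alpha> \<cdot>\<^sub>a \<delta>" .
      show "carries (act p) (\<alpha> \<cdot>\<^sub>a digit v i \<cdot>\<^sub>a \<delta>) (digit v i \<cdot>\<^sub>a \<alpha> \<cdot>\<^sub>a \<delta>)"
        using p(2)[OF \<beta>, unfolded sb] unfolding \<beta>_def .
    next
      fix \<delta> :: "'n address" and d
      assume "carries (act p) (\<alpha> \<cdot>\<^sub>a digit v i \<cdot>\<^sub>a \<delta> \<cdot>\<^sub>a digit False d) (digit v i \<cdot>\<^sub>a \<alpha> \<cdot>\<^sub>a \<delta> \<cdot>\<^sub>a digit False d)"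
        "carries (act p) (\<alpha> \<cdot>\<^sub>a digit v i \<cdot>\<^sub>a \<delta> \<cdot>\<^sub>a digit True d) (digit v i \<cdot>\<^sub>a \<alpha> \<cdot>\<^sub>a \<delta> \<cdot>\<^sub>a digit True d)"
      then show "carries (act p) (\<alpha> \<cdot>\<^sub>a digit v i \<cdot>\<^sub>a \<delta>) (digit v i \<cdot>\<^sub>a \<alpha> \<cdot>\<^sub>a \<delta>)"
        by - (rule carries_split[where d = d], simp_all add: addr_mult_assoc)
    qed
    then show ?thesis by simp
  qed
  then show ?thesis
    using p(1) unfolding rotates_def by blast
qed

text \<open>
  Every point lies in a cylinder \<open>\<alpha>\<langle>u\<rangle>\<^sub>i\<close> with \<open>\<alpha>\<close> in \<open>A\<close>, so the action is prescribed everywhere, and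
  length-preserving elements are determined by their action.
\<close>

lemma rotates_unique:
  fixes A :: "'n::finite address set"
  assumes "addr_partition A" "rotates i A p" "rotates i A q"
  shows "p = q"
proof (rule lenpres_faithful)
  show "p \<in> lenpres" "q \<in> lenpres"
    using assms by (auto simp: rotates_def)
  show "act p = act q"
  proof
    fix x
    obtain \<alpha> y where \<alpha>: "\<alpha> \<in> A" "x = \<alpha> \<frown>\<^sub>a y"
      using assms(1) unfolding addr_partition_def by (metis in_cylinderE)
    obtain u w where y: "y = digit u i \<frown>\<^sub>a w"
      using digit_cover[of y i] by blast
    have "carries (act p) (\<alpha> \<cdot>\<^sub>a digit u i) (digit u i \<cdot>\<^sub>a \<alpha>)" "carries (act q) (\<alpha> \<cdot>\<^sub>a digit u i) (digit u i \<cdot>\<^sub>a \<alpha>)"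
      using assms \<alpha>(1) by (auto simp: rotates_def)
    then show "act p x = act q x"
      unfolding carries_def \<alpha>(2) y app_mult by simp
  qed
qed

text \<open>
  The difference between the rotations of a partition before and after \<open>\<alpha>\<close> is split in direction
  \<open>d\<close>: on the cylinder of \<open>\<alpha>\<close> the digit in coordinate \<open>i\<close> has to move past the new digit in coordinate
  \<open>d\<close>. Digits in different coordinates commute.
\<close>

definition shuffle :: "'n \<Rightarrow> 'n address \<Rightarrow> 'n \<Rightarrow> 'n nV_pres"
  where "shuffle i \<alpha> d = (if d = i then
    pfx \<alpha> (tr (digit False i \<cdot>\<^sub>a digit True i) (digit True i \<cdot>\<^sub>a digit False i)) else 0)"

lemma digit_commute: "d \<noteq> i \<Longrightarrow> digit u d \<cdot>\<^sub>a digit v i = digit v i \<cdot>\<^sub>a digit u d"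
  by (auto simp: addr_mult_def addr_single_def fun_eq_iff)

lemma carries_shuffle:
  "carries (act (shuffle i \<alpha> d)) (\<alpha> \<cdot>\<^sub>a digit v d \<cdot>\<^sub>a digit u i) (\<alpha> \<cdot>\<^sub>a digit u i \<cdot>\<^sub>a digit v d)"
proof (cases "d = i")
  case True
  have p: "digit False i \<cdot>\<^sub>a digit True i \<bottom>\<^sub>a digit True i \<cdot>\<^sub>a digit False i"
    using perp_extend[OF perp_digits] .
  have q: "digit u i \<cdot>\<^sub>a digit u i \<bottom>\<^sub>a digit v i \<cdot>\<^sub>a digit (\<not> v) i" for u v
    by (cases u; cases v) (simp_all add: perp_digits perp_digits_sym perp_extend)
  have "carries (transposition (digit False i \<cdot>\<^sub>a digit True i) (digit True i \<cdot>\<^sub>a digit False i))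
      (digit v i \<cdot>\<^sub>a digit u i) (digit u i \<cdot>\<^sub>a digit v i)"
    using carries_transposition[OF p] q[of _ False] q[of _ True]
    by (cases u; cases v) auto
  then show ?thesis
    using True p by (simp add: shuffle_def carries_def app_mult act_pfx_app act_tr)
qed (simp add: shuffle_def digit_commute)

lemma carries_shuffle_perp: "\<beta> \<bottom>\<^sub>a \<alpha> \<Longrightarrow> carries (act (shuffle i \<alpha> d)) \<beta> \<beta>"
  by (simp add: shuffle_def carries_pfx_perp)

lemma lenpres_shuffle: "shuffle i \<alpha> d \<in> lenpres"
  by (auto simp: shuffle_def pfx_tr alen_mult alen_digit intro!: lenpres_tr lenpres.zero)

text \<open>
  The difference depends on \<open>\<alpha>\<close> only through the position of its cylinder, so it is compatible with
  every \<open>w\<close> that carries \<open>\<alpha>\<close>.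
\<close>

lemma shuffle_conj:
  fixes w :: "'n::finite nV_pres"
  assumes "carries (act w) \<alpha> \<beta>"
  shows "shuffle i \<alpha> d + w = w + shuffle i \<beta> d"
  using pfx_conj_carries[OF assms] by (simp add: shuffle_def conj_eq_iff)

lemma rotates_split_at:
  assumes "addr_partition A" "\<alpha> \<in> A" "rotates i A p"
  shows "rotates i (split_at A \<alpha> d) (shuffle i \<alpha> d + p)"
  unfolding rotates_def
proof (intro conjI ballI allI)
  have p: "p \<in> lenpres" "\<And>\<beta> u. \<beta> \<in> A \<Longrightarrow> carries (act p) (\<beta> \<cdot>\<^sub>a digit u i) (digit u i \<cdot>\<^sub>a \<beta>)"
    using assms(3) by (auto simp: rotates_def)
  show "shuffle i \<alpha> d + p \<in> lenpres"
    using p(1) lenpres_shuffle by (rule lenpres_add)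
  fix \<beta> u assume "\<beta> \<in> split_at A \<alpha> d"
  then consider "\<beta> \<in> A" "\<beta> \<noteq> \<alpha>" | v where "\<beta> = \<alpha> \<cdot>\<^sub>a digit v d"
    by (auto simp: split_at_def)
  then show "carries (act (shuffle i \<alpha> d + p)) (\<beta> \<cdot>\<^sub>a digit u i) (digit u i \<cdot>\<^sub>a \<beta>)"
  proof cases
    case 1
    then have "\<beta> \<bottom>\<^sub>a \<alpha>"
      using assms(1,2) by (auto simp: addr_partition_def pairwise_def)
    then show ?thesis
      unfolding act_add
      by (intro carries_comp[OF carries_mult[OF carries_shuffle_perp] p(2)[OF 1(1)]])
  next
    case 2
    have "carries (act (shuffle i \<alpha> d)) (\<beta> \<cdot>\<^sub>a digit u i) ((\<alpha> \<cdot>\<^sub>a digit u i) \<cdot>\<^sub>a digit v d)"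
      using carries_shuffle[of i \<alpha> d v u] by (simp add: 2 addr_mult_assoc)
    moreover have "carries (act p) ((\<alpha> \<cdot>\<^sub>a digit u i) \<cdot>\<^sub>a digit v d) (digit u i \<cdot>\<^sub>a \<beta>)"
      using carries_mult[OF p(2)[OF assms(2)], of u "digit v d"] by (simp add: 2 addr_mult_assoc)
    ultimately show ?thesis
      unfolding act_add by (rule carries_comp)
  qed
qed

section \<open>Doubling\<close>

definition double :: "'n \<Rightarrow> 'n nV_pres \<Rightarrow> 'n nV_pres"
  where "double i w = pfx (digit False i) w + pfx (digit True i) w"

text \<open>
  The copies in the two halves commute, having disjoint supports.
\<close>

lemma double_add: "double i (v + w) = double i v + double i w" for v w :: "'n::finite nV_pres"
proof -
  have "carries (act (pfx (digit False i) w)) (digit True i) (digit True i)"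
    by (rule carries_pfx_perp[OF perp_digits_sym])
  then have "pfx (digit True i) v + pfx (digit False i) w = pfx (digit False i) w + pfx (digit True i) v"
    using pfx_conj_carries by (simp only: conj_eq_iff)
  then have "pfx (digit False i) v + (pfx (digit True i) v + pfx (digit False i) w) + pfx (digit True i) w
    = pfx (digit False i) v + (pfx (digit False i) w + pfx (digit True i) v) + pfx (digit True i) w"
    by simp
  then show ?thesis
    by (simp only: double_def pfx_add add.assoc)
qed

text \<open>
  The identity \<open>w h\<^sub>B = h\<^sub>A (double w)\<close> in the presented group, where \<open>f\<close> is the bijection from \<open>A\<close> to
  \<open>B\<close> induced by \<open>w\<close>.
\<close>

definition doubles_on :: "'n \<Rightarrow> 'n nV_pres \<Rightarrow> 'n address set \<Rightarrow> bool"
  where "doubles_on i w A \<longleftrightarrow> (\<exists>f p q. (\<forall>\<alpha>\<in>A. carries (act w) \<alpha> (f \<alpha>)) \<and>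
    rotates i A p \<and> rotates i (f ` A) q \<and> w + q = p + double i w)"

lemma doubles_on_iff:
  fixes A :: "'n::finite address set"
  assumes "addr_partition A" "\<And>\<alpha>. \<alpha> \<in> A \<Longrightarrow> carries (act w) \<alpha> (f \<alpha>)" "rotates i A p" "rotates i (f ` A) q"
  shows "doubles_on i w A \<longleftrightarrow> w + q = p + double i w"
proof
  assume "doubles_on i w A"
  then obtain f' p' q' where h: "\<And>\<alpha>. \<alpha> \<in> A \<Longrightarrow> carries (act w) \<alpha> (f' \<alpha>)" "rotates i A p'"
      "rotates i (f' ` A) q'" "w + q' = p' + double i w"
    unfolding doubles_on_def by blast
  have "f' ` A = f ` A"
    using carries_unique[OF h(1) assms(2)] by (intro image_cong) auto
  moreover have "addr_partition (f ` A)"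
    using addr_partition_image[OF assms(1) bij_act assms(2)] .
  ultimately have "p' = p" "q' = q"
    using h assms rotates_unique by metis+
  then show "w + q = p + double i w"
    using h(4) by simp
qed (use assms in \<open>auto simp: doubles_on_def\<close>)

text \<open>
  Both rotations change by a shuffle on the left, and \<open>w\<close> intertwines the two shuffles, so they
  cancel.
\<close>

lemma doubles_on_split_at:
  fixes A :: "'n::finite address set"
  assumes A: "addr_partition A" "\<alpha> \<in> A" and c: "\<And>\<alpha>. \<alpha> \<in> A \<Longrightarrow> \<exists>\<beta>. carries (act w) \<alpha> \<beta>"
  shows "doubles_on i w (split_at A \<alpha> d) \<longleftrightarrow> doubles_on i w A"
proof -
  obtain f where f: "\<And>\<alpha>. \<alpha> \<in> A \<Longrightarrow> carries (act w) \<alpha> (f \<alpha>)"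
    using c by metis
  have fA: "addr_partition (f ` A)"
    using addr_partition_image[OF A(1) bij_act f] .
  obtain p q where p: "rotates i A p" and q: "rotates i (f ` A) q"
    using rotates_exists A(1) fA by blast
  \<comment> \<open>The bijection that w induces on the split partition.\<close>
  define f' where "f' = (\<lambda>\<beta>. if \<beta> = \<alpha> \<cdot>\<^sub>a digit False d then f \<alpha> \<cdot>\<^sub>a digit False d
    else if \<beta> = \<alpha> \<cdot>\<^sub>a digit True d then f \<alpha> \<cdot>\<^sub>a digit True d else f \<beta>)"
  have perp: "\<beta> \<bottom>\<^sub>a \<alpha>" if "\<beta> \<in> A - {\<alpha>}" for \<beta>
    using that A by (auto simp: addr_partition_def pairwise_def)
  have ne: "digit True d \<noteq> digit False d"
    using perp_digits[of d] by (metis perp_irrefl)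
  have f'A: "f' \<beta> = f \<beta>" if "\<beta> \<in> A - {\<alpha>}" for \<beta>
  proof -
    have "\<beta> \<noteq> \<alpha> \<cdot>\<^sub>a \<delta>" for \<delta>
      using perp_extend[OF perp[OF that], of root \<delta>] by auto
    then show ?thesis by (simp add: f'_def)
  qed
  have f'\<alpha>: "f' (\<alpha> \<cdot>\<^sub>a digit u d) = f \<alpha> \<cdot>\<^sub>a digit u d" for u
    using ne by (cases u) (auto simp: f'_def)
  have f'_carries: "carries (act w) \<beta> (f' \<beta>)" if "\<beta> \<in> split_at A \<alpha> d" for \<beta>
    using that f f'A f'\<alpha> A(2) by (auto simp: split_at_def carries_mult)
  have "f ` (A - {\<alpha>}) = f ` A - {f \<alpha>}"
  proof -
    have "f \<beta> \<bottom>\<^sub>a f \<alpha>" if "\<beta> \<in> A - {\<alpha>}" for \<beta>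
      using carries_perp[OF inj_act f f perp[OF that]] that A(2) by simp
    then have "f \<beta> \<noteq> f \<alpha>" if "\<beta> \<in> A - {\<alpha>}" for \<beta>
      using that by (metis perp_irrefl)
    then show ?thesis by auto
  qed
  moreover have "f' ` (A - {\<alpha>}) = f ` (A - {\<alpha>})"
    using f'A by (intro image_cong) auto
  ultimately have "f' ` split_at A \<alpha> d = split_at (f ` A) (f \<alpha>) d"
    by (simp add: split_at_def image_Un f'\<alpha>)
  then have q': "rotates i (f' ` split_at A \<alpha> d) (shuffle i (f \<alpha>) d + q)"
    using rotates_split_at[OF fA _ q] A(2) by simp
  have "doubles_on i w (split_at A \<alpha> d) \<longleftrightarrow>
      w + (shuffle i (f \<alpha>) d + q) = (shuffle i \<alpha> d + p) + double i w"
    using addr_partition_split_at[OF A] f'_carries rotates_split_at[OF A p] q' by (rule doubles_on_iff)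
  also have "w + (shuffle i (f \<alpha>) d + q) = shuffle i \<alpha> d + (w + q)"
    using shuffle_conj[OF f[OF A(2)], of i d] by (simp only: add.assoc[symmetric])
  also have "shuffle i \<alpha> d + (w + q) = (shuffle i \<alpha> d + p) + double i w \<longleftrightarrow> w + q = p + double i w"
    by (simp add: add.assoc)
  also have "\<dots> \<longleftrightarrow> doubles_on i w A"
    using doubles_on_iff[OF A(1) f p q] by simp
  finally show ?thesis .
qed

lemma doubles_on_level:
  fixes A :: "'n::finite address set"
  assumes "addr_partition A" "\<And>\<alpha>. \<alpha> \<in> A \<Longrightarrow> alen \<alpha> \<le> N" "\<And>\<alpha>. \<alpha> \<in> A \<Longrightarrow> \<exists>\<beta>. carries (act w) \<alpha> \<beta>"
  shows "doubles_on i w A \<longleftrightarrow> doubles_on i w (level N)"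
proof -
  have "(\<forall>\<alpha>\<in>A. \<exists>\<beta>. carries (act w) \<alpha> \<beta>) \<longrightarrow> (doubles_on i w A \<longleftrightarrow> doubles_on i w (level N))"
    using assms(1,2)
  proof (rule partition_refine_induct[where N = N and
        Q = "\<lambda>A. (\<forall>\<alpha>\<in>A. \<exists>\<beta>. carries (act w) \<alpha> \<beta>) \<longrightarrow> (doubles_on i w A \<longleftrightarrow> doubles_on i w (level N))"])
    fix A \<alpha> d
    assume A: "addr_partition A" "\<alpha> \<in> A"
      and IH: "(\<forall>\<beta>\<in>split_at A \<alpha> d. \<exists>\<gamma>. carries (act w) \<beta> \<gamma>) \<longrightarrow>
        (doubles_on i w (split_at A \<alpha> d) \<longleftrightarrow> doubles_on i w (level N))"
    show "(\<forall>\<alpha>\<in>A. \<exists>\<beta>. carries (act w) \<alpha> \<beta>) \<longrightarrow> (doubles_on i w A \<longleftrightarrow> doubles_on i w (level N))"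
    proof
      assume c: "\<forall>\<alpha>\<in>A. \<exists>\<beta>. carries (act w) \<alpha> \<beta>"
      then have "\<forall>\<beta>\<in>split_at A \<alpha> d. \<exists>\<gamma>. carries (act w) \<beta> \<gamma>"
        using A(2) carries_mult unfolding split_at_def by blast
      then show "doubles_on i w A \<longleftrightarrow> doubles_on i w (level N)"
        using IH doubles_on_split_at[OF A] c by simp
    qed
  next
    show "(\<forall>\<alpha>\<in>level N. \<exists>\<beta>. carries (act w) \<alpha> \<beta>) \<longrightarrow> (doubles_on i w (level N) \<longleftrightarrow> doubles_on i w (level N))"
      by (rule impI) (rule HOL.refl)
  qed
  then show ?thesis
    using assms(3) by blast
qed

lemma doubles_on_independent:
  fixes A :: "'n::finite address set"
  assumes "addr_partition A" "\<And>\<alpha>. \<alpha> \<in> A \<Longrightarrow> \<exists>\<beta>. carries (act w) \<alpha> \<beta>"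
    "addr_partition B" "\<And>\<alpha>. \<alpha> \<in> B \<Longrightarrow> \<exists>\<beta>. carries (act w) \<alpha> \<beta>"
  shows "doubles_on i w A \<longleftrightarrow> doubles_on i w B"
proof -
  define N where "N = (\<lambda>d. \<Sum>\<alpha>\<in>A \<union> B. alen \<alpha> d)"
  have fin: "finite (A \<union> B)"
    using assms by (simp add: addr_partition_def)
  have "alen \<alpha> \<le> N" if "\<alpha> \<in> A \<union> B" for \<alpha>
    unfolding N_def le_fun_def by (intro allI member_le_sum[OF that _ fin]) simp
  then show ?thesis
    using doubles_on_level[OF assms(1) _ assms(2)] doubles_on_level[OF assms(3) _ assms(4)] by blast
qed

lemma doubles_on_zero: "doubles_on i 0 {root :: 'n::finite address}"
  by (auto simp: doubles_on_def rotates_def lenpres.zero double_def intro!: exI[of _ id] exI[of _ 0])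

text \<open>
  For a partition that contains both \<open>\<alpha>\<close> and \<open>\<beta>\<close>, the generator permutes the partition, and
  conjugation by its rotation \<open>p\<close> turns the two factors \<open>tr (\<alpha>\<langle>u\<rangle>\<^sub>i) (\<beta>\<langle>u\<rangle>\<^sub>i)\<close> of the third relation
  into the two factors of the doubled generator.
\<close>

lemma doubles_on_tr:
  fixes \<alpha> \<beta> :: "'n::finite address"
  assumes "\<alpha> \<bottom>\<^sub>a \<beta>"
  shows "\<exists>A. addr_partition A \<and> doubles_on i (tr \<alpha> \<beta>) A"
proof -
  define N where "N = (\<lambda>d. alen \<alpha> d + alen \<beta> d)"
  \<comment> \<open>The complement of the two cylinders is a union of cylinders of the level.\<close>
  define A where "A = {\<alpha>, \<beta>} \<union> {\<gamma> \<in> level N. \<gamma> \<bottom>\<^sub>a \<alpha> \<and> \<gamma> \<bottom>\<^sub>a \<beta>}"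
  have "\<exists>\<delta>\<in>A. x \<in> cylinder \<delta>" for x
  proof -
    obtain \<gamma> where \<gamma>: "\<gamma> \<in> level N" "x \<in> cylinder \<gamma>"
      using level_cover by blast
    have "\<gamma> \<bottom>\<^sub>a \<delta> \<or> x \<in> cylinder \<delta>" if "\<delta> \<in> {\<alpha>, \<beta>}" for \<delta>
    proof -
      have "alen \<delta> \<le> alen \<gamma>"
        using that \<gamma>(1) by (auto simp: level_def N_def le_fun_def)
      then have "\<gamma> \<bottom>\<^sub>a \<delta> \<or> (\<exists>\<epsilon>. \<gamma> = \<delta> \<cdot>\<^sub>a \<epsilon>)"
        using comparable_or_perp perp_sym by blast
      then show ?thesis
        using \<gamma>(2) by (auto simp: cylinder_def app_mult)
    qed
    then show ?thesis
      using \<gamma> by (auto simp: A_def)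
  qed
  moreover have "pairwise addr_perp A"
    using assms perp_sym level_perp unfolding A_def pairwise_def by blast
  ultimately have A: "addr_partition A"
    using finite_level[of N] by (auto simp: addr_partition_def A_def)
  define f where "f = (\<lambda>\<gamma>. if \<gamma> = \<alpha> then \<beta> else if \<gamma> = \<beta> then \<alpha> else \<gamma>)"
  have f: "carries (act (tr \<alpha> \<beta>)) \<gamma> (f \<gamma>)" if "\<gamma> \<in> A" for \<gamma>
    using that carries_transposition[OF assms] by (auto simp: act_tr[OF assms] A_def f_def)
  have "f ` A = A"
    by (auto simp: A_def f_def)
  obtain p where p: "rotates i A p"
    using rotates_exists[OF A] by blast
  have "- p + tr (\<alpha> \<cdot>\<^sub>a digit u i) (\<beta> \<cdot>\<^sub>a digit u i) + p = pfx (digit u i) (tr \<alpha> \<beta>)" for u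
    unfolding pfx_tr using p assms
    by (intro tr_conj_carries) (auto simp: rotates_def A_def intro: perp_extend)
  then have "- p + tr \<alpha> \<beta> + p = double i (tr \<alpha> \<beta>)"
    unfolding double_def by (simp only: tr_split[OF assms, of i] conj_add)
  then have "tr \<alpha> \<beta> + p = p + double i (tr \<alpha> \<beta>)"
    by (simp only: conj_eq_iff)
  then have "doubles_on i (tr \<alpha> \<beta>) A"
    using doubles_on_iff[OF A f p] p \<open>f ` A = A\<close> by simp
  then show ?thesis
    using A by blast
qed

text \<open>
  On a common partition \<open>C\<close> the rotation of the intermediate partition \<open>f ` C\<close> cancels. Choosing \<open>C\<close>
  fine enough uses that the identity does not depend on the partition.
\<close>

lemma doubles_on_add:
  fixes v w :: "'n::finite nV_pres"
  assumes "addr_partition A" "doubles_on i v A" "addr_partition B" "doubles_on i w B"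
  shows "\<exists>C. addr_partition C \<and> doubles_on i (v + w) C"
proof -
  obtain L M where L: "conewise (act v) L" and M: "conewise (act w) M"
    using conewise_act by blast
  \<comment> \<open>Fine enough for v to act, with images fine enough for w to act.\<close>
  define C where "C = level (\<lambda>d. L d + M d)"
  have C: "addr_partition C"
    unfolding C_def by (rule addr_partition_level)
  have "\<exists>\<gamma>'. carries (act v) \<gamma> \<gamma>' \<and> M \<le> alen \<gamma>'" if "\<gamma> \<in> C" for \<gamma>
  proof -
    have "(\<lambda>d. L d + M d) \<le> alen \<gamma>"
      using that by (simp add: C_def level_def)
    then show ?thesis
      using conewise_imageE[OF L] by blast
  qed
  then obtain f where f: "\<And>\<gamma>. \<gamma> \<in> C \<Longrightarrow> carries (act v) \<gamma> (f \<gamma>)" "\<And>\<gamma>. \<gamma> \<in> C \<Longrightarrow> M \<le> alen (f \<gamma>)"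
    by metis
  have fC: "addr_partition (f ` C)"
    using addr_partition_image[OF C bij_act f(1)] .
  have "\<exists>\<gamma>'. carries (act w) \<gamma> \<gamma>'" if "\<gamma> \<in> f ` C" for \<gamma>
    using that f(2) M unfolding conewise_def by blast
  then obtain g where g: "\<And>\<gamma>. \<gamma> \<in> f ` C \<Longrightarrow> carries (act w) \<gamma> (g \<gamma>)"
    by metis
  have gC: "addr_partition (g ` f ` C)"
    using addr_partition_image[OF fC bij_act g] .
  obtain p q r where p: "rotates i C p" and q: "rotates i (f ` C) q" and r: "rotates i (g ` f ` C) r"
    using rotates_exists C fC gC by metis
  have vA: "\<exists>\<beta>. carries (act v) \<alpha> \<beta>" if "\<alpha> \<in> A" for \<alpha>
    using assms(2) that unfolding doubles_on_def by blast
  have wB: "\<exists>\<beta>. carries (act w) \<alpha> \<beta>" if "\<alpha> \<in> B" for \<alpha>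
    using assms(4) that unfolding doubles_on_def by blast
  have "doubles_on i v C"
    using doubles_on_independent[OF assms(1) vA C] f(1) assms(2) by blast
  then have v: "v + q = p + double i v"
    using doubles_on_iff[OF C f(1) p q] by blast
  have "doubles_on i w (f ` C)"
    using doubles_on_independent[OF assms(3) wB fC] g assms(4) by blast
  then have w: "w + r = q + double i w"
    using doubles_on_iff[OF fC g q r] by blast
  have "(v + w) + r = v + (w + r)"
    by (simp only: add.assoc)
  also have "\<dots> = (v + q) + double i w"
    by (simp only: w add.assoc)
  also have "\<dots> = p + double i (v + w)"
    by (simp only: v double_add add.assoc)
  finally have eq: "(v + w) + r = p + double i (v + w)" .
  have gf: "carries (act (v + w)) \<gamma> ((g \<circ> f) \<gamma>)" if "\<gamma> \<in> C" for \<gamma>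
    unfolding act_add using carries_comp[OF f(1)[OF that] g] that by simp
  have "rotates i ((g \<circ> f) ` C) r"
    using r by (simp only: image_comp)
  then have "doubles_on i (v + w) C"
    using doubles_on_iff[OF C gf p] eq by blast
  then show ?thesis
    using C by blast
qed

lemma doubles_on_exists:
  fixes w :: "'n::finite nV_pres"
  shows "\<exists>A. addr_partition A \<and> doubles_on i w A"
proof (induction w rule: nV_pres_induct)
  case zero
  show ?case
    using addr_partition_root doubles_on_zero by blast
next
  case (step p \<alpha> \<beta>)
  then show ?case
    using doubles_on_add doubles_on_tr by blast
qed

lemma kernel_double:
  fixes k :: "'n::finite nV_pres"
  assumes "act k = id"
  shows "double i k = k"
proof -
  have c: "carries (act k) \<alpha> (id \<alpha>)" for \<alpha>
    using assms by simp
  obtain A where A: "addr_partition A" "doubles_on i k A"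
    using doubles_on_exists by blast
  have "doubles_on i k A \<longleftrightarrow> doubles_on i k {root}"
    using c by (intro doubles_on_independent[OF A(1) _ addr_partition_root] exI)
  then have "doubles_on i k {root}"
    using A(2) by simp
  moreover have "rotates i {root} 0"
    by (auto simp: rotates_def lenpres.zero)
  ultimately show ?thesis
    using doubles_on_iff[OF addr_partition_root c, of i 0 0] by simp
qed

text \<open>
  The two copies are conjugate by the generator that exchanges the cylinders, and the copy at \<open>\<zeta>\<close> also
  lies in the kernel, hence is central.
\<close>

lemma kernel_pfx_perp:
  fixes k :: "'n::finite nV_pres"
  assumes "act k = id" "\<zeta> \<bottom>\<^sub>a \<eta>"
  shows "pfx \<zeta> k = pfx \<eta> k"
proof -
  have "act (pfx \<zeta> k) x = x" for x
  proof (cases "x \<in> cylinder \<zeta>")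
    case True
    then show ?thesis
      using assms(1) by (auto simp: act_pfx_app elim!: in_cylinderE)
  next
    case False
    show ?thesis
      using False
    proof (induction k rule: nV_pres_induct)
      case (step p \<alpha> \<beta>)
      then have "x \<notin> cylinder (\<zeta> \<cdot>\<^sub>a \<gamma>)" for \<gamma>
        by (auto simp: cylinder_def app_mult)
      with step show ?case
        by (simp add: pfx_add act_add pfx_tr act_tr transposition_fix)
    qed simp
  qed
  then have "act (pfx \<zeta> k) = id"
    by (simp add: fun_eq_iff)
  then have "pfx \<zeta> k + tr \<zeta> \<eta> = tr \<zeta> \<eta> + pfx \<zeta> k"
    by (rule kernel_central)
  moreover have "- tr \<zeta> \<eta> + pfx \<zeta> k + tr \<zeta> \<eta> = pfx \<eta> k"
    using assms(2) by (intro pfx_conj_carries) (simp add: act_tr carries_transposition)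
  ultimately show ?thesis
    by (simp only: conj_eq_iff add_left_cancel)
qed

text \<open>
  With \<open>y\<close> the copy of \<open>k\<close> in either half, doubling gives \<open>k = y + y\<close>. The copy of \<open>y\<close> at 0 is the
  copy of \<open>k\<close> at 00, which equals the copy at 1, that is, \<open>y\<close>. So the copy of the equation at 0 reads
  \<open>y = y + y\<close>.
\<close>

lemma act_faithful:
  fixes k :: "'n::finite nV_pres"
  assumes "act k = id"
  shows "k = 0"
proof -
  fix i :: 'n
  let ?O = "digit False i" and ?I = "digit True i"
  define y where "y = pfx ?O k"
  have k: "k = y + y"
    using kernel_double[OF assms, of i] kernel_pfx_perp[OF assms perp_digits, of i]
    by (simp add: double_def y_def)
  have "pfx ?O y = pfx (?O \<cdot>\<^sub>a ?O) k"
    by (simp add: y_def pfx_pfx)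
  also have "\<dots> = pfx ?I k"
    by (rule kernel_pfx_perp[OF assms perp_extend_left[OF perp_digits]])
  also have "\<dots> = y"
    using kernel_pfx_perp[OF assms perp_digits, of i] by (simp add: y_def)
  finally have "pfx ?O y = y" .
  then have "y = y + y"
    using arg_cong[OF k, of "pfx ?O"] by (simp only: pfx_add y_def[symmetric])
  then have "y + 0 = y + y"
    by simp
  then have "0 = y"
    by (simp only: add_left_cancel)
  then show "k = 0"
    using k by simp
qed

section \<open>The elements of nV\<close>

lemma conewise_partition:
  fixes A :: "'n::finite address set"
  assumes "addr_partition A" "\<And>\<alpha>. \<alpha> \<in> A \<Longrightarrow> \<exists>\<beta>. carries g \<alpha> \<beta>"
  shows "\<exists>L. conewise g L"
proof
  define L where "L = (\<lambda>d. \<Sum>\<alpha>\<in>A. alen \<alpha> d)"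
  show "conewise g L"
    unfolding conewise_def
  proof (intro allI impI)
    fix \<gamma> assume \<gamma>: "L \<le> alen \<gamma>"
    obtain \<alpha> where \<alpha>: "\<alpha> \<in> A" "\<gamma> \<frown>\<^sub>a undefined \<in> cylinder \<alpha>"
      using assms(1) unfolding addr_partition_def by blast
    then have "\<not> \<alpha> \<bottom>\<^sub>a \<gamma>"
      unfolding perp_iff_disjoint using app_in_cylinder by blast
    moreover have "alen \<alpha> \<le> L"
      unfolding L_def le_fun_def using assms(1) \<alpha>(1)
      by (intro allI member_le_sum) (auto simp: addr_partition_def)
    ultimately obtain \<delta> where "\<gamma> = \<alpha> \<cdot>\<^sub>a \<delta>"
      using comparable_or_perp \<gamma> order_trans by metis
    then show "\<exists>\<gamma>'. carries g \<gamma> \<gamma>'"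
      using assms(2)[OF \<alpha>(1)] carries_mult by blast
  qed
qed

lemma addr_partition_of_cylinder_partition:
  assumes "cylinder_partition k \<alpha>"
  shows "addr_partition (\<alpha> ` {1..k})"
proof -
  have "\<alpha> i \<bottom>\<^sub>a \<alpha> j" if "i \<in> {1..k}" "j \<in> {1..k}" "\<alpha> i \<noteq> \<alpha> j" for i j
    using assms that unfolding perp_iff_disjoint cylinder_partition_def disjoint_family_on_def by metis
  then have "pairwise addr_perp (\<alpha> ` {1..k})"
    by (auto simp: pairwise_def)
  moreover have "\<exists>\<gamma>\<in>\<alpha> ` {1..k}. x \<in> cylinder \<gamma>" for x
  proof -
    have "x \<in> (\<Union>i\<in>{1..k}. cylinder (\<alpha> i))"
      using assms by (simp add: cylinder_partition_def)
    then show ?thesis by auto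
  qed
  ultimately show ?thesis
    by (simp add: addr_partition_def)
qed

lemma cylinder_partition_of_bij:
  assumes "addr_partition A" "bij_betw \<alpha> {1..k} A"
  shows "cylinder_partition k \<alpha>"
proof -
  have "\<alpha> i \<bottom>\<^sub>a \<alpha> j" if "i \<in> {1..k}" "j \<in> {1..k}" "i \<noteq> j" for i j
  proof -
    have "\<alpha> i \<in> A" "\<alpha> j \<in> A" "\<alpha> i \<noteq> \<alpha> j"
      using that bij_betw_apply[OF assms(2)] inj_on_eq_iff[OF bij_betw_imp_inj_on[OF assms(2)]] by simp_all
    then show ?thesis
      using assms(1) by (simp add: addr_partition_def pairwise_def)
  qed
  then have "disjoint_family_on (\<lambda>i. cylinder (\<alpha> i)) {1..k}"
    by (simp add: disjoint_family_on_def perp_iff_disjoint)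
  moreover have "(\<Union>i\<in>{1..k}. cylinder (\<alpha> i)) = (\<Union>\<gamma>\<in>A. cylinder \<gamma>)"
    using assms(2) by (auto simp: bij_betw_def)
  moreover have "(\<Union>\<gamma>\<in>A. cylinder \<gamma>) = UNIV"
    using assms(1) by (auto simp: addr_partition_def)
  ultimately show ?thesis
    by (simp add: cylinder_partition_def)
qed

lemma continuous_coordinate: "continuous_on UNIV (\<lambda>x :: 'n cantor. x d j)"
  by (rule continuous_on_product_then_coordinatewise[OF continuous_on_product_coordinates])

lemma open_cylinder: "open (cylinder (\<alpha> :: 'n::finite address))"
proof -
  have 1: "open ((\<lambda>x :: 'n cantor. x d j) -` {b})" for d j b
    by (rule open_vimage[OF open_discrete continuous_coordinate])
  have "cylinder \<alpha> = (\<Inter>d. \<Inter>j\<in>{..<length (\<alpha> d)}. (\<lambda>x. x d j) -` {\<alpha> d ! j})"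
    by (rule Set.set_eqI) (simp only: cylinder_iff INT_iff vimage_eq singleton_iff lessThan_iff Ball_def UNIV_I simp_thms)
  then show ?thesis
    using 1 by (auto intro!: open_INT)
qed

lemma conewise_continuous:
  fixes g :: "'n::finite cantor \<Rightarrow> 'n cantor"
  assumes "conewise g L"
  shows "continuous_on UNIV g"
proof -
  have "continuous_on (cylinder \<gamma>) g" if \<gamma>: "\<gamma> \<in> level L" for \<gamma>
  proof -
    obtain \<gamma>' where \<gamma>': "carries g \<gamma> \<gamma>'"
      using assms \<gamma> by (auto simp: conewise_def level_def)
    define h :: "'n cantor \<Rightarrow> 'n cantor" where "h = (\<lambda>x d j. if j < length (\<gamma>' d) then \<gamma>' d ! j else x d (length (\<gamma> d) + (j - length (\<gamma>' d))))"
    have "continuous_on UNIV (\<lambda>x. h x d j)" for d j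
      by (cases "j < length (\<gamma>' d)") (simp_all add: h_def continuous_coordinate)
    then have "continuous_on UNIV h"
      by (intro continuous_on_coordinatewise_then_product)
    moreover have "g x = h x" if "x \<in> cylinder \<gamma>" for x
    proof -
      obtain w where x: "x = \<gamma> \<frown>\<^sub>a w"
        using \<open>x \<in> cylinder \<gamma>\<close> by (rule in_cylinderE)
      show ?thesis
      proof (intro ext)
        fix d j
        show "g x d j = h x d j"
        proof (cases "j < length (\<gamma>' d)")
          case False
          then obtain m where "j = length (\<gamma>' d) + m"
            by (metis le_Suc_ex not_less)
          then show ?thesis
            by (simp add: x carriesD[OF \<gamma>'] h_def app_nth)
        qed (simp add: x carriesD[OF \<gamma>'] h_def app_nth)
      qed
    qed
    ultimately show ?thesis
      using continuous_on_subset continuous_on_cong by (metis top_greatest)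
  qed
  then have "continuous_on (\<Union>\<gamma>\<in>level L. cylinder \<gamma>) g"
    by (intro continuous_on_open_UN) (auto simp: open_cylinder)
  moreover have "(\<Union>\<gamma>\<in>level L. cylinder \<gamma>) = UNIV"
    using level_cover by blast
  ultimately show ?thesis by simp
qed

lemma conewise_level:
  assumes "conewise g L"
  shows "\<exists>f. \<forall>\<gamma>\<in>level L. carries g \<gamma> (f \<gamma>)"
proof (rule bchoice, rule ballI)
  fix \<gamma> assume "\<gamma> \<in> level L"
  then show "\<exists>\<gamma>'. carries g \<gamma> \<gamma>'"
    using assms by (simp add: conewise_def level_def)
qed

text \<open>
  Continuity is automatic: a conewise bijection shifts coordinates on each cylinder of a level, and its
  inverse is conewise for the image of that partition.
\<close>

lemma carrier_nV_iff:
  fixes g :: "'n::finite cantor \<Rightarrow> 'n cantor"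
  shows "g \<in> carrier nV \<longleftrightarrow> bij g \<and> (\<exists>L. conewise g L)"
proof
  assume "g \<in> carrier nV"
  then obtain h k \<alpha> \<beta> where h: "homeomorphism UNIV UNIV g h" and \<alpha>: "cylinder_partition k \<alpha>"
    and g: "\<And>i w. i \<in> {1..k} \<Longrightarrow> g (\<alpha> i \<frown>\<^sub>a w) = \<beta> i \<frown>\<^sub>a w"
    unfolding nV_def by auto
  have "bij g"
    using h unfolding homeomorphism_def by (metis bij_betw_byWitness top_greatest UNIV_I)
  moreover have "\<exists>L. conewise g L"
    using addr_partition_of_cylinder_partition[OF \<alpha>] g
    by (intro conewise_partition) (auto simp: carries_def)
  ultimately show "bij g \<and> (\<exists>L. conewise g L)" by blast
next
  assume "bij g \<and> (\<exists>L. conewise g L)"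
  then obtain L where bij: "bij g" and L: "conewise g L" by blast
  obtain f where f: "\<And>\<gamma>. \<gamma> \<in> level L \<Longrightarrow> carries g \<gamma> (f \<gamma>)"
    using conewise_level[OF L] by blast
  have part: "addr_partition (f ` level L)"
    using addr_partition_image[OF addr_partition_level bij f] .
  have inv: "carries (inv_into UNIV g) (f \<gamma>) \<gamma>" if "\<gamma> \<in> level L" for \<gamma>
    using f[OF that] bij unfolding carries_def by (metis bij_is_inj inv_f_f)
  have "\<exists>M. conewise (inv_into UNIV g) M"
    using inv by (intro conewise_partition[OF part]) blast
  then obtain M where M: "conewise (inv_into UNIV g) M" by blast
  have hom: "homeomorphism UNIV UNIV g (inv_into UNIV g)"
    using bij conewise_continuous[OF L] conewise_continuous[OF M]
    by (auto simp: homeomorphism_def bij_is_surj bij_is_inj surj_f_inv_f bij_imp_bij_inv)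
  obtain \<alpha> where \<alpha>: "bij_betw \<alpha> {1..card (level L)} (level L)"
    using ex_bij_betw_nat_finite_1[OF finite_level[of L]] by auto
  have "inj_on f (level L)"
    using inv carries_unique by (metis inj_onI)
  then have f\<alpha>: "bij_betw (f \<circ> \<alpha>) {1..card (level L)} (f ` level L)"
    using \<alpha> by (intro bij_betw_trans) (auto simp: bij_betw_def)
  have eq: "\<forall>i\<in>{1..card (level L)}. \<forall>w. g (\<alpha> i \<frown>\<^sub>a w) = (f \<circ> \<alpha>) i \<frown>\<^sub>a w"
    using f \<alpha> by (auto simp: bij_betw_def carries_def)
  show "g \<in> carrier nV"
    unfolding nV_def partial_object.simps
    by (intro CollectI conjI exI[of _ "inv_into UNIV g"] exI[of _ "card (level L)"] exI[of _ \<alpha>] exI[of _ "f \<circ> \<alpha>"]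
        hom eq cylinder_partition_of_bij[OF addr_partition_level \<alpha>] cylinder_partition_of_bij[OF part f\<alpha>])
qed

lemma act_in_nV: "act p \<in> carrier nV" for p :: "'n::finite nV_pres"
  using carrier_nV_iff bij_act conewise_act by blast

section \<open>Surjectivity\<close>

text \<open>
  The analogue of \<^const>\<open>pfx\<close> for maps.
\<close>

definition map_pfx :: "'n address \<Rightarrow> ('n cantor \<Rightarrow> 'n cantor) \<Rightarrow> 'n cantor \<Rightarrow> 'n cantor"
  where "map_pfx \<zeta> g x = (if x \<in> cylinder \<zeta> then \<zeta> \<frown>\<^sub>a g (THE w. x = \<zeta> \<frown>\<^sub>a w) else x)"

lemma map_pfx_app: "map_pfx \<zeta> g (\<zeta> \<frown>\<^sub>a x) = \<zeta> \<frown>\<^sub>a g x"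
  by (simp add: map_pfx_def)

lemma map_pfx_outside: "x \<notin> cylinder \<zeta> \<Longrightarrow> map_pfx \<zeta> g x = x"
  by (simp add: map_pfx_def)

lemma map_pfx_comp: "map_pfx \<zeta> (g \<circ> h) = map_pfx \<zeta> g \<circ> map_pfx \<zeta> h"
proof
  show "map_pfx \<zeta> (g \<circ> h) x = (map_pfx \<zeta> g \<circ> map_pfx \<zeta> h) x" for x
    by (cases "x \<in> cylinder \<zeta>") (auto simp: map_pfx_app map_pfx_outside elim!: in_cylinderE)
qed

lemma map_pfx_id: "map_pfx \<zeta> id = id"
proof
  show "map_pfx \<zeta> id x = id x" for x
    by (cases "x \<in> cylinder \<zeta>") (auto simp: map_pfx_app map_pfx_outside elim!: in_cylinderE)
qed

lemma app_in_cylinder_mult: "\<zeta> \<frown>\<^sub>a x \<in> cylinder (\<zeta> \<cdot>\<^sub>a \<eta>) \<longleftrightarrow> x \<in> cylinder \<eta>"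
  by (auto simp: cylinder_def app_mult)

lemma map_pfx_map_pfx: "map_pfx \<zeta> (map_pfx \<eta> g) = map_pfx (\<zeta> \<cdot>\<^sub>a \<eta>) g"
proof
  fix x
  show "map_pfx \<zeta> (map_pfx \<eta> g) x = map_pfx (\<zeta> \<cdot>\<^sub>a \<eta>) g x"
  proof (cases "x \<in> cylinder \<zeta>")
    case True
    then obtain y where y: "x = \<zeta> \<frown>\<^sub>a y" by (rule in_cylinderE)
    show ?thesis
    proof (cases "y \<in> cylinder \<eta>")
      case True
      then obtain w where "y = \<eta> \<frown>\<^sub>a w" by (rule in_cylinderE)
      then show ?thesis
        using map_pfx_app[of "\<zeta> \<cdot>\<^sub>a \<eta>" g w] by (simp add: y map_pfx_app app_mult)
    qed (simp add: y map_pfx_app map_pfx_outside app_in_cylinder_mult)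
  next
    case False
    then have "x \<notin> cylinder (\<zeta> \<cdot>\<^sub>a \<eta>)"
      by (auto simp: cylinder_def app_mult)
    then show ?thesis
      using False by (simp add: map_pfx_outside)
  qed
qed

lemma map_pfx_nV:
  fixes g :: "'n::finite cantor \<Rightarrow> 'n cantor"
  assumes "g \<in> carrier nV"
  shows "map_pfx \<zeta> g \<in> carrier nV"
proof -
  obtain L where bij: "bij g" and L: "conewise g L"
    using assms carrier_nV_iff by blast
  have "map_pfx \<zeta> (inv_into UNIV g) \<circ> map_pfx \<zeta> g = id" "map_pfx \<zeta> g \<circ> map_pfx \<zeta> (inv_into UNIV g) = id"
    using inv_o_cancel[OF bij_is_inj[OF bij]] surj_iff[THEN iffD1, OF bij_is_surj[OF bij]]
    by (simp_all only: map_pfx_comp[symmetric] map_pfx_id)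
  then have "bij (map_pfx \<zeta> g)"
    by (rule o_bij)
  moreover have "conewise (map_pfx \<zeta> g) (\<lambda>d. alen \<zeta> d + L d)"
    unfolding conewise_def
  proof (intro allI impI)
    fix \<gamma> assume \<gamma>: "(\<lambda>d. alen \<zeta> d + L d) \<le> alen \<gamma>"
    show "\<exists>\<gamma>'. carries (map_pfx \<zeta> g) \<gamma> \<gamma>'"
    proof (cases "\<gamma> \<bottom>\<^sub>a \<zeta>")
      case True
      then have "\<gamma> \<frown>\<^sub>a x \<notin> cylinder \<zeta>" for x
        unfolding perp_iff_disjoint using app_in_cylinder by blast
      then have "carries (map_pfx \<zeta> g) \<gamma> \<gamma>"
        by (simp add: carries_def map_pfx_outside)
      then show ?thesis by (rule exI[of _ \<gamma>])
    next
      case False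
      have "alen \<zeta> \<le> alen \<gamma>"
        using \<gamma> by (auto simp: le_fun_def intro: add_leD1)
      then obtain \<delta> where \<delta>: "\<gamma> = \<zeta> \<cdot>\<^sub>a \<delta>"
        using comparable_or_perp[of \<zeta> \<gamma>] False perp_sym[of \<gamma>] by auto
      then have "L \<le> alen \<delta>"
        using \<gamma> by (simp add: alen_mult le_fun_def)
      then obtain \<delta>' where "carries g \<delta> \<delta>'"
        using L unfolding conewise_def by blast
      then have "carries (map_pfx \<zeta> g) \<gamma> (\<zeta> \<cdot>\<^sub>a \<delta>')"
        by (simp add: \<delta> carries_def app_mult map_pfx_app)
      then show ?thesis by (rule exI[of _ "\<zeta> \<cdot>\<^sub>a \<delta>'"])
    qed
  qed
  ultimately show ?thesis
    using carrier_nV_iff by blast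
qed

lemma transposition_map_pfx:
  assumes "\<zeta> \<bottom>\<^sub>a \<eta>"
  shows "transposition \<zeta> \<eta> \<circ> map_pfx \<zeta> g \<circ> transposition \<zeta> \<eta> = map_pfx \<eta> g"
proof
  fix x
  have out: "\<zeta> \<frown>\<^sub>a y \<notin> cylinder \<eta>" "\<eta> \<frown>\<^sub>a y \<notin> cylinder \<zeta>" for y
    using assms unfolding perp_iff_disjoint using app_in_cylinder by blast+
  show "(transposition \<zeta> \<eta> \<circ> map_pfx \<zeta> g \<circ> transposition \<zeta> \<eta>) x = map_pfx \<eta> g x"
    by (rule transposition_cases[where x = x and \<alpha> = \<zeta> and \<beta> = \<eta>])
      (simp_all add: transposition_app1 transposition_app2[OF assms] transposition_fix
        map_pfx_app map_pfx_outside out)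
qed

text \<open>
  The image of \<^const>\<open>act\<close> is normalised by nV: a transposition is a product of transpositions of
  long addresses, which \<open>g\<close> carries to other addresses.
\<close>

lemma act_normal:
  fixes g :: "'n::finite cantor \<Rightarrow> 'n cantor"
  assumes "g \<in> carrier nV"
  shows "\<exists>q. g \<circ> act p = act q \<circ> g"
proof (induction p rule: nV_pres_induct)
  case zero
  have "g \<circ> act 0 = act 0 \<circ> g" by simp
  then show ?case ..
next
  case (step p \<alpha> \<beta>)
  obtain L where bij: "bij g" and L: "conewise g L"
    using assms carrier_nV_iff by blast
  have "\<exists>q. g \<circ> act (tr (\<alpha> \<cdot>\<^sub>a root) (\<beta> \<cdot>\<^sub>a root)) = act q \<circ> g"
  proof (rule split_induct[where L = L and Q = "\<lambda>\<delta>. \<exists>q. g \<circ> act (tr (\<alpha> \<cdot>\<^sub>a \<delta>) (\<beta> \<cdot>\<^sub>a \<delta>)) = act q \<circ> g"])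
    fix \<delta> :: "'n address"
    assume "alen \<delta> = L"
    then have "L \<le> alen (\<alpha> \<cdot>\<^sub>a \<delta>)" "L \<le> alen (\<beta> \<cdot>\<^sub>a \<delta>)"
      by (simp_all add: alen_mult le_fun_def)
    then obtain \<alpha>' \<beta>' where c: "carries g (\<alpha> \<cdot>\<^sub>a \<delta>) \<alpha>'" "carries g (\<beta> \<cdot>\<^sub>a \<delta>) \<beta>'"
      using L unfolding conewise_def by metis
    note p = perp_extend[OF step.hyps, of \<delta> \<delta>]
    have "g \<circ> act (tr (\<alpha> \<cdot>\<^sub>a \<delta>) (\<beta> \<cdot>\<^sub>a \<delta>)) = act (tr \<alpha>' \<beta>') \<circ> g"
      using transposition_conj[OF bij_is_inj[OF bij] c p] carries_perp[OF bij_is_inj[OF bij] c p]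
      by (intro ext) (simp add: act_tr p)
    then show "\<exists>q. g \<circ> act (tr (\<alpha> \<cdot>\<^sub>a \<delta>) (\<beta> \<cdot>\<^sub>a \<delta>)) = act q \<circ> g" ..
  next
    fix \<delta> :: "'n address" and d
    let ?t = "\<lambda>u. tr (\<alpha> \<cdot>\<^sub>a \<delta> \<cdot>\<^sub>a digit u d) (\<beta> \<cdot>\<^sub>a \<delta> \<cdot>\<^sub>a digit u d)"
    assume "\<exists>q. g \<circ> act (?t False) = act q \<circ> g" "\<exists>q. g \<circ> act (?t True) = act q \<circ> g"
    then obtain q r where q: "g \<circ> act (?t False) = act q \<circ> g" and r: "g \<circ> act (?t True) = act r \<circ> g"
      by blast
    have "tr (\<alpha> \<cdot>\<^sub>a \<delta>) (\<beta> \<cdot>\<^sub>a \<delta>) = ?t False + ?t True"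
      using tr_split[OF perp_extend[OF step.hyps], of \<delta> \<delta> d] by (simp only: addr_mult_assoc)
    then have "g \<circ> act (tr (\<alpha> \<cdot>\<^sub>a \<delta>) (\<beta> \<cdot>\<^sub>a \<delta>)) = act (q + r) \<circ> g"
      by (intro ext) (simp add: act_add fun_cong[OF q, unfolded o_apply] fun_cong[OF r, unfolded o_apply])
    then show "\<exists>q. g \<circ> act (tr (\<alpha> \<cdot>\<^sub>a \<delta>) (\<beta> \<cdot>\<^sub>a \<delta>)) = act q \<circ> g" ..
  qed
  then obtain r where r: "g \<circ> act (tr \<alpha> \<beta>) = act r \<circ> g" by auto
  obtain q where q: "g \<circ> act p = act q \<circ> g"
    using step.IH by blast
  have "g \<circ> act (p + tr \<alpha> \<beta>) = act (q + r) \<circ> g"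
    by (intro ext) (simp add: act_add fun_cong[OF q, unfolded o_apply] fun_cong[OF r, unfolded o_apply])
  then show ?case ..
qed

text \<open>
  Equality modulo the image of \<^const>\<open>act\<close>; by normality it is a congruence on nV.
\<close>

definition cong_act :: "('n cantor \<Rightarrow> 'n cantor) \<Rightarrow> ('n cantor \<Rightarrow> 'n cantor) \<Rightarrow> bool"
  where "cong_act g h \<longleftrightarrow> (\<exists>p. h = act p \<circ> g)"

lemma cong_act_sym:
  assumes "cong_act g h"
  shows "cong_act h g"
proof -
  obtain p where "h = act p \<circ> g"
    using assms by (auto simp: cong_act_def)
  then have "g = act (- p) \<circ> h"
    by (intro ext) (simp add: act_uminus)
  then show ?thesis
    unfolding cong_act_def ..
qed

lemma cong_act_trans [trans]:
  assumes "cong_act g h" "cong_act h k"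
  shows "cong_act g k"
proof -
  obtain p q where "h = act p \<circ> g" "k = act q \<circ> h"
    using assms by (auto simp: cong_act_def)
  then have "k = act (p + q) \<circ> g"
    by (simp add: act_add comp_assoc)
  then show ?thesis
    unfolding cong_act_def ..
qed

lemma cong_act_comp:
  fixes g g' h h' :: "'n::finite cantor \<Rightarrow> 'n cantor"
  assumes "g \<in> carrier nV" "cong_act g g'" "cong_act h h'"
  shows "cong_act (g \<circ> h) (g' \<circ> h')"
proof -
  obtain p q where p: "g' = act p \<circ> g" and q: "h' = act q \<circ> h"
    using assms by (auto simp: cong_act_def)
  obtain r where r: "g \<circ> act q = act r \<circ> g"
    using act_normal[OF assms(1)] by blast
  have "g' \<circ> h' = act (r + p) \<circ> (g \<circ> h)"
    by (intro ext) (simp add: p q act_add fun_cong[OF r, unfolded o_apply])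
  then show ?thesis
    unfolding cong_act_def ..
qed

lemma cong_act_map_pfx:
  fixes g :: "'n::finite cantor \<Rightarrow> 'n cantor"
  assumes "g \<in> carrier nV" "\<zeta> \<bottom>\<^sub>a \<eta>"
  shows "cong_act (map_pfx \<zeta> g) (map_pfx \<eta> g)"
proof -
  let ?t = "tr \<zeta> \<eta>"
  obtain q where q: "map_pfx \<zeta> g \<circ> act ?t = act q \<circ> map_pfx \<zeta> g"
    using act_normal[OF map_pfx_nV[OF assms(1)]] by blast
  have "map_pfx \<eta> g = act ?t \<circ> (map_pfx \<zeta> g \<circ> act ?t)"
    using transposition_map_pfx[OF assms(2), of g] by (simp add: act_tr[OF assms(2)] comp_assoc)
  also have "\<dots> = act (q + ?t) \<circ> map_pfx \<zeta> g"
    by (simp only: q act_add comp_assoc)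
  finally show ?thesis
    unfolding cong_act_def ..
qed

text \<open>
  The identity \<open>g h\<^sub>B = h\<^sub>A (double g)\<close> for maps, where the rotations lie in the image of
  \<^const>\<open>act\<close>.
\<close>

lemma cong_act_double:
  fixes g :: "'n::finite cantor \<Rightarrow> 'n cantor"
  assumes "g \<in> carrier nV"
  shows "cong_act g (map_pfx (digit False i) g \<circ> map_pfx (digit True i) g)"
proof -
  let ?D = "map_pfx (digit False i) g \<circ> map_pfx (digit True i) g"
  obtain L where bij: "bij g" and L: "conewise g L"
    using assms carrier_nV_iff by blast
  obtain f where f: "\<And>\<gamma>. \<gamma> \<in> level L \<Longrightarrow> carries g \<gamma> (f \<gamma>)"
    using conewise_level[OF L] by blast
  obtain p where p: "rotates i (level L) p"
    using rotates_exists[OF addr_partition_level] by blast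
  obtain q where q: "rotates i (f ` level L) q"
    using rotates_exists[OF addr_partition_image[OF addr_partition_level bij f]] by blast
  have D: "?D (digit u i \<frown>\<^sub>a x) = digit u i \<frown>\<^sub>a g x" for u x
  proof -
    have "digit False i \<frown>\<^sub>a y \<notin> cylinder (digit True i)" "digit True i \<frown>\<^sub>a y \<notin> cylinder (digit False i)" for y
      using perp_digits[of i] unfolding perp_iff_disjoint using app_in_cylinder by blast+
    then show ?thesis
      by (cases u) (simp_all add: map_pfx_app map_pfx_outside)
  qed
  have eq: "act q (g x) = ?D (act p x)" for x
  proof -
    obtain \<gamma> y where \<gamma>: "\<gamma> \<in> level L" "x = \<gamma> \<frown>\<^sub>a y"
      using level_cover by (metis in_cylinderE)
    obtain u w where y: "y = digit u i \<frown>\<^sub>a w"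
      using digit_cover[of y i] by blast
    have "carries (act p) (\<gamma> \<cdot>\<^sub>a digit u i) (digit u i \<cdot>\<^sub>a \<gamma>)"
      using p \<gamma>(1) by (simp add: rotates_def)
    then have "act p x = digit u i \<frown>\<^sub>a \<gamma> \<frown>\<^sub>a w"
      unfolding carries_def app_mult \<gamma>(2) y by simp
    moreover have "carries (act q) (f \<gamma> \<cdot>\<^sub>a digit u i) (digit u i \<cdot>\<^sub>a f \<gamma>)"
      using q \<gamma>(1) by (simp add: rotates_def)
    then have "act q (f \<gamma> \<frown>\<^sub>a digit u i \<frown>\<^sub>a w) = digit u i \<frown>\<^sub>a f \<gamma> \<frown>\<^sub>a w"
      unfolding carries_def app_mult by simp
    ultimately show ?thesis
      by (simp only: D carriesD[OF f[OF \<gamma>(1)]] \<gamma>(2) y)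
  qed
  obtain r where r: "g \<circ> act (- p) = act r \<circ> g"
    using act_normal[OF assms] by blast
  have "?D x = (act (r + q) \<circ> g) x" for x
    using eq[of "act (- p) x"] fun_cong[OF r, of x] by (simp add: act_uminus act_add)
  then have "?D = act (r + q) \<circ> g"
    by (rule ext)
  then show ?thesis
    unfolding cong_act_def ..
qed

text \<open>
  The computation of \<open>act_faithful\<close> modulo the image of \<^const>\<open>act\<close>. The copy \<open>k\<close> of \<open>g\<close> at 0 is
  congruent to \<open>k \<circ> k\<close>, so \<open>k\<close> is in the image, and \<open>g\<close> is congruent to \<open>k \<circ> k\<close>.
\<close>

lemma act_surjective:
  fixes g :: "'n::finite cantor \<Rightarrow> 'n cantor"
  assumes g: "g \<in> carrier nV"
  shows "\<exists>p. g = act p"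
proof -
  fix i :: 'n
  let ?O = "digit False i" and ?I = "digit True i"
  define k where "k = map_pfx ?O g"
  have k: "k \<in> carrier nV"
    unfolding k_def using g by (rule map_pfx_nV)
  have IO: "cong_act (map_pfx ?I g) k"
    unfolding k_def by (rule cong_act_map_pfx[OF g perp_digits_sym])
  have "cong_act (map_pfx ?O k) (map_pfx ?I g)"
    unfolding k_def map_pfx_map_pfx by (rule cong_act_map_pfx[OF g perp_extend_left[OF perp_digits]])
  then have O: "cong_act (map_pfx ?O k) k"
    using IO by (rule cong_act_trans)
  have I: "cong_act (map_pfx ?I k) k"
    unfolding k_def map_pfx_map_pfx by (rule cong_act_map_pfx[OF g perp_extend_left[OF perp_digits_sym]])
  have "cong_act k (k \<circ> k)"
    using cong_act_double[OF k] cong_act_comp[OF map_pfx_nV[OF k] O I] by (rule cong_act_trans)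
  then obtain p where p: "k \<circ> k = act p \<circ> k"
    by (auto simp: cong_act_def)
  have "surj k"
    using k carrier_nV_iff bij_is_surj by blast
  then have kp: "k = act p"
    using p by (metis comp_apply ext surjD)
  have refl: "cong_act k k"
    unfolding cong_act_def by (rule exI[of _ 0]) simp
  have "cong_act g (k \<circ> map_pfx ?I g)"
    using cong_act_double[OF g] unfolding k_def .
  also have "cong_act (k \<circ> map_pfx ?I g) (k \<circ> k)"
    using cong_act_comp[OF k refl IO] .
  finally have "cong_act (k \<circ> k) g"
    by (rule cong_act_sym)
  then obtain r where "g = act r \<circ> (act p \<circ> act p)"
    by (auto simp: cong_act_def kp)
  then have "g = act (p + p + r)"
    by (simp only: act_add)
  then show "\<exists>p. g = act p" ..
qed

section \<open>The presentation\<close>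

lemma act_inject:
  fixes p q :: "'n::finite nV_pres"
  assumes "act p = act q"
  shows "p = q"
proof -
  have "act (p + - q) = id"
    unfolding act_add assms using act_uminus(1)[of q] by (intro ext) (simp only: o_apply id_apply)
  then have "p + - q = 0"
    by (rule act_faithful)
  then show ?thesis
    by (simp add: add_eq_0_iff2)
qed

lemma act_abs: "w \<in> gwords nV_gens \<Longrightarrow> act (abs_nV_pres w) = word_map w"
  by (simp add: act.abs_eq pres_cong.refl)

lemma word_map_inject:
  fixes u v :: "('n::finite address \<times> 'n address) gword"
  assumes "u \<in> gwords nV_gens" "v \<in> gwords nV_gens" "word_map u = word_map v"
  shows "(u, v) \<in> pres_cong nV_gens nV_rels"
proof -
  have "abs_nV_pres u = abs_nV_pres v"
    using assms by (intro act_inject) (simp add: act_abs)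
  then show ?thesis
    using assms(1,2) Quotient_rel[OF Quotient_nV_pres, of u v] by (simp add: pres_cong.refl)
qed

theorem theorem1p1:
  assumes "CARD('n::finite) \<ge> 2"
  shows "has_presentation (nV :: ('n cantor \<Rightarrow> 'n cantor) monoid)
    (\<lambda>(\<alpha>, \<beta>). transposition \<alpha> \<beta>) nV_gens nV_rels"
proof -
  let ?W = "gwords nV_gens :: ('n address \<times> 'n address) gword set"
  let ?P = "presented_group (nV_gens :: ('n address \<times> 'n address) set) nV_rels"
  let ?c = "pres_class (nV_gens :: ('n address \<times> 'n address) set) nV_rels"
  define h :: "('n address \<times> 'n address) gword set \<Rightarrow> 'n cantor \<Rightarrow> 'n cantor"
    where "h = (\<lambda>X. the_elem (word_map ` X))"
  have h: "h (?c w) = word_map w" if "w \<in> ?W" for w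
  proof -
    have "w \<in> ?c w"
      using that by (auto simp: pres_class_def intro: pres_cong.refl)
    moreover have "word_map v = word_map w" if "v \<in> ?c w" for v
      using that word_map_cong[of w v] by (simp add: pres_class_def)
    ultimately have "word_map ` ?c w = {word_map w}"
      by (metis (no_types, lifting) image_cong image_constant)
    then show ?thesis
      by (simp add: h_def)
  qed
  have app: "u @ v \<in> ?W" if "u \<in> ?W" "v \<in> ?W" for u v
    using that by (auto simp: gwords_def)
  have "h \<in> hom ?P nV"
  proof (rule homI)
    show "h X \<in> carrier nV" if "X \<in> carrier ?P" for X
      using that act_in_nV by (auto simp: carrier_presented_group h act_abs[symmetric])
    show "h (X \<otimes>\<^bsub>?P\<^esub> Y) = h X \<otimes>\<^bsub>nV\<^esub> h Y" if "X \<in> carrier ?P" "Y \<in> carrier ?P" for X Y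
      using that by (auto simp: carrier_presented_group pres_class_mult h app word_map_append nV_def)
  qed
  moreover have "inj_on h (carrier ?P)"
  proof (rule inj_onI)
    fix X Y assume "X \<in> carrier ?P" "Y \<in> carrier ?P" and eq: "h X = h Y"
    then obtain u v where uv: "u \<in> ?W" "X = ?c u" "v \<in> ?W" "Y = ?c v"
      by (auto simp: carrier_presented_group)
    then have "(u, v) \<in> pres_cong nV_gens nV_rels"
      using eq by (intro word_map_inject) (simp_all add: h)
    then show "X = Y"
      unfolding uv pres_class_def by (rule equiv_class_eq[OF equiv_pres_cong])
  qed
  moreover have "h ` carrier ?P = carrier nV"
  proof
    show "h ` carrier ?P \<subseteq> carrier nV"
      using act_in_nV by (auto simp: carrier_presented_group h act_abs[symmetric])
    show "carrier nV \<subseteq> h ` carrier ?P"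
    proof
      fix g :: "'n cantor \<Rightarrow> 'n cantor"
      assume "g \<in> carrier nV"
      then obtain p where "g = act p"
        using act_surjective by blast
      moreover obtain w where "w \<in> ?W" "p = abs_nV_pres w"
        by (induction p rule: nV_pres.abs_induct) (use pres_cong_gwords(1) in blast)
      ultimately have "g = h (?c w)" "?c w \<in> carrier ?P"
        by (simp_all add: act_abs h carrier_presented_group)
      then show "g \<in> h ` carrier ?P" by blast
    qed
  qed
  ultimately have "h \<in> iso ?P nV"
    by (simp add: iso_def bij_betw_def)
  moreover have "\<forall>a\<in>nV_gens. h (?c (gen a)) = (case a of (\<alpha>, \<beta>) \<Rightarrow> transposition \<alpha> \<beta>)"
  proof
    fix a :: "'n address \<times> 'n address"
    assume a: "a \<in> nV_gens"
    obtain \<alpha> \<beta> where ab: "a = (\<alpha>, \<beta>)" by (cases a)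
    have "gen a \<in> ?W"
      using a by (simp add: gen_def gwords_def)
    moreover have "word_map (gen a) = transposition \<alpha> \<beta>"
      by (rule ext) (simp add: ab gen_def)
    ultimately show "h (?c (gen a)) = (case a of (\<alpha>, \<beta>) \<Rightarrow> transposition \<alpha> \<beta>)"
      by (simp only: h ab prod.case)
  qed
  ultimately show ?thesis
    unfolding has_presentation_def by (intro bexI[of _ h])
qed

end
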